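(* Let $(M,\langle\cdot,\cdot\rangle^*,dv_M)$ be an $(m+1)$-dimensional subriemannian manifold with a background volume form $dv_M$. Suppose it has isometric translations $\Psi_a$, $a\in(-\delta,\delta)$, $\delta>0$, near $p_0\in M$, transversal to a hypersurface $\Sigma$ passing through $p_0$. Then there exist local coordinates $x^1,x^2,\dots,x^{m+1}$ in a neighborhood $V$ of $p_0$ such that: (1) $\Sigma$ is described by $x^{m+1}=0$ in $V$, $p_0$ is the origin, and for $q\in V$ and any $a$ such that $\Psi_a(q)\in V$ one has $x^j\circ\Psi_a=x^j$ at $q$ for $1\le j\le m$, and $x^{m+1}\circ\Psi_a=x^{m+1}+a$ at $q$; (2) writing $dv_M(q)=A(q)\,dx^1\wedge\dots\wedge dx^{m+1}$, one has $A(\Psi_a(q))=A(q)$ for any $q\in V$ and any $a$ such that $\Psi_a(q)\in V$.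
   Context: A subriemannian manifold is a $C^\infty$ manifold $M$ with a (smooth) nonnegative definite inner product $\langle\cdot,\cdot\rangle^*$ on $T^*M$ (possibly degenerate). A background volume form $dv_M$ is a nowhere vanishing form of top degree. Isometric translations near $p_0$: a one-parameter family of local diffeomorphisms $\Psi_a$, $a\in(-\delta,\delta)$ ($\delta>0$ small), in a small neighborhood $U$ of $p_0$, with $\Psi_0=\mathrm{Id}$, $\Psi_{a+b}=\Psi_a\circ\Psi_b$ wherever defined, such that $\langle\Psi_a^*\omega,\Psi_a^*\eta\rangle^*=\langle\omega,\eta\rangle^*$ for $\omega,\eta\in T^*U$ and $\Psi_a^*(dv_M)=dv_M$. $\{\Psi_a\}$ is transversal to a hypersurface $\Sigma$ if $\frac{d}{da}\Psi_a(x)|_{a=0}\notin T_x\Sigma$ for all $x\in\Sigma$.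
   Formalization: The parameter a in (1) and (2) ranges over a possibly smaller interval (-d,d), 0<d≤δ, chosen with V; for a fixed δ the claim fails when an orbit returns to p_0 within time δ (e.g. a rotation of a circle with period less than δ). *)

theory Defs
  imports "HOL-Analysis.Analysis"
begin

subsection \<open>Smooth maps between open sets of normed spaces\<close>

primrec k_times_differentiable_on ::
  "nat \<Rightarrow> 'a::real_normed_vector set \<Rightarrow> ('a \<Rightarrow> 'b::real_normed_vector) \<Rightarrow> bool" where
  "k_times_differentiable_on 0 S f \<longleftrightarrow> continuous_on S f"
| "k_times_differentiable_on (Suc k) S f \<longleftrightarrow>
     (\<forall>x\<in>S. f differentiable (at x)) \<and>
     (\<forall>v. k_times_differentiable_on k S (\<lambda>x. frechet_derivative f (at x) v))"

text \<open>\<open>C\<^sup>\<infinity>\<close> on \<open>S\<close>; only used for open \<open>S\<close>.\<close>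

definition smooth_on :: "'a::real_normed_vector set \<Rightarrow> ('a \<Rightarrow> 'b::real_normed_vector) \<Rightarrow> bool" where
  "smooth_on S f \<longleftrightarrow> (\<forall>k. k_times_differentiable_on k S f)"


subsection \<open>Smooth manifolds\<close>

text \<open>
  The manifold is the whole (Hausdorff, second countable) type \<open>'a\<close>; its dimension is \<open>CARD('n)\<close>.
  A chart is a pair of its domain and its coordinate map; values of the coordinate map outside
  the domain carry no meaning.
\<close>

type_synonym ('a, 'n) chart = "'a set \<times> ('a \<Rightarrow> real^'n)"

definition is_chart ::
  "'a::{t2_space,second_countable_topology} set \<Rightarrow> ('a \<Rightarrow> real^'n::finite) \<Rightarrow> bool" where
  "is_chart V \<phi> \<longleftrightarrow> open V \<and> open (\<phi> ` V) \<and> inj_on \<phi> V \<and>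
     homeomorphism V (\<phi> ` V) \<phi> (inv_into V \<phi>)"

definition smoothly_compatible ::
  "'a::{t2_space,second_countable_topology} set \<Rightarrow> ('a \<Rightarrow> real^'n::finite) \<Rightarrow>
   'a set \<Rightarrow> ('a \<Rightarrow> real^'n) \<Rightarrow> bool" where
  "smoothly_compatible V \<phi> W \<psi> \<longleftrightarrow>
     smooth_on (\<phi> ` (V \<inter> W)) (\<psi> \<circ> inv_into V \<phi>) \<and>
     smooth_on (\<psi> ` (V \<inter> W)) (\<phi> \<circ> inv_into W \<psi>)"

text \<open>A smooth structure is a maximal smooth atlas, so its members are all the local coordinates.\<close>

definition smooth_structure ::
  "('a::{t2_space,second_countable_topology}, 'n::finite) chart set \<Rightarrow> bool" where
  "smooth_structure \<A> \<longleftrightarrow>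
     (\<forall>(V, \<phi>)\<in>\<A>. is_chart V \<phi>) \<and>
     (\<Union>(V, \<phi>)\<in>\<A>. V) = UNIV \<and>
     (\<forall>(V, \<phi>)\<in>\<A>. \<forall>(W, \<psi>)\<in>\<A>. smoothly_compatible V \<phi> W \<psi>) \<and>
     (\<forall>V \<phi>. is_chart V \<phi> \<and> (\<forall>(W, \<psi>)\<in>\<A>. smoothly_compatible V \<phi> W \<psi>) \<longrightarrow> (V, \<phi>) \<in> \<A>)"

definition smooth_fun ::
  "('a::{t2_space,second_countable_topology}, 'n::finite) chart set \<Rightarrow>
   'a set \<Rightarrow> ('a \<Rightarrow> real) \<Rightarrow> bool" where
  "smooth_fun \<A> U f \<longleftrightarrow> (\<forall>(V, \<phi>)\<in>\<A>. smooth_on (\<phi> ` (V \<inter> U)) (f \<circ> inv_into V \<phi>))"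

definition smooth_near ::
  "('a::{t2_space,second_countable_topology}, 'n::finite) chart set \<Rightarrow>
   'a \<Rightarrow> ('a \<Rightarrow> real) \<Rightarrow> bool" where
  "smooth_near \<A> p f \<longleftrightarrow> (\<exists>U. open U \<and> p \<in> U \<and> smooth_fun \<A> U f)"

definition smooth_curve ::
  "('a::{t2_space,second_countable_topology}, 'n::finite) chart set \<Rightarrow>
   real set \<Rightarrow> (real \<Rightarrow> 'a) \<Rightarrow> bool" where
  "smooth_curve \<A> I \<gamma> \<longleftrightarrow> continuous_on I \<gamma> \<and>
     (\<forall>(V, \<phi>)\<in>\<A>. smooth_on {t\<in>I. \<gamma> t \<in> V} (\<phi> \<circ> \<gamma>))"

definition smooth_map ::
  "('a::{t2_space,second_countable_topology}, 'n::finite) chart set \<Rightarrow>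
   'a set \<Rightarrow> ('a \<Rightarrow> 'a) \<Rightarrow> bool" where
  "smooth_map \<A> U F \<longleftrightarrow> continuous_on U F \<and>
     (\<forall>(V, \<phi>)\<in>\<A>. \<forall>(W, \<psi>)\<in>\<A>.
        smooth_on (\<phi> ` {q\<in>V \<inter> U. F q \<in> W}) (\<psi> \<circ> F \<circ> inv_into V \<phi>))"

text \<open>Joint smoothness of \<open>(a, q) \<mapsto> \<Psi> a q\<close> on \<open>I \<times> U\<close>.\<close>

definition smooth_family ::
  "('a::{t2_space,second_countable_topology}, 'n::finite) chart set \<Rightarrow>
   real set \<Rightarrow> 'a set \<Rightarrow> (real \<Rightarrow> 'a \<Rightarrow> 'a) \<Rightarrow> bool" where
  "smooth_family \<A> I U \<Psi> \<longleftrightarrow> continuous_on (I \<times> U) (\<lambda>(a, q). \<Psi> a q) \<and>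
     (\<forall>(V, \<phi>)\<in>\<A>. \<forall>(W, \<psi>)\<in>\<A>.
        smooth_on {(a, \<phi> q) |a q. a \<in> I \<and> q \<in> V \<inter> U \<and> \<Psi> a q \<in> W}
          (\<lambda>(a, y). \<psi> (\<Psi> a (inv_into V \<phi> y))))"

definition local_diffeo ::
  "('a::{t2_space,second_countable_topology}, 'n::finite) chart set \<Rightarrow>
   'a set \<Rightarrow> ('a \<Rightarrow> 'a) \<Rightarrow> bool" where
  "local_diffeo \<A> U F \<longleftrightarrow>
     (\<forall>p\<in>U. \<exists>W. open W \<and> p \<in> W \<and> W \<subseteq> U \<and> open (F ` W) \<and> inj_on F W \<and>
        smooth_map \<A> W F \<and> smooth_map \<A> (F ` W) (inv_into W F))"


subsection \<open>Tangent and cotangent spaces\<close>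

text \<open>
  A tangent vector at \<open>p\<close> is the operator \<open>f \<mapsto> (f \<circ> \<gamma>)'(0)\<close> of differentiation along a smooth
  curve \<open>\<gamma>\<close> through \<open>p\<close>, acting on functions that are smooth near \<open>p\<close>.  All other functions
  are sent to \<open>0\<close>, so that tangent vectors are equal iff they agree on functions smooth
  near \<open>p\<close>.  Vector space operations are pointwise.  Likewise, covectors are extended by \<open>0\<close>
  outside the tangent space.
\<close>

type_synonym 'a tangent = "('a \<Rightarrow> real) \<Rightarrow> real"
type_synonym 'a cotangent = "'a tangent \<Rightarrow> real"

definition velocity ::
  "('a::{t2_space,second_countable_topology}, 'n::finite) chart set \<Rightarrow>
   (real \<Rightarrow> 'a) \<Rightarrow> 'a tangent" where
  "velocity \<A> \<gamma> = (\<lambda>f. if smooth_near \<A> (\<gamma> 0) f then deriv (f \<circ> \<gamma>) 0 else 0)"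

definition tangent_space ::
  "('a::{t2_space,second_countable_topology}, 'n::finite) chart set \<Rightarrow> 'a \<Rightarrow> 'a tangent set" where
  "tangent_space \<A> p =
     {velocity \<A> \<gamma> |\<gamma>. \<gamma> 0 = p \<and> (\<exists>e>0. smooth_curve \<A> {-e<..<e} \<gamma>)}"

definition cotangent_space ::
  "('a::{t2_space,second_countable_topology}, 'n::finite) chart set \<Rightarrow> 'a \<Rightarrow> 'a cotangent set" where
  "cotangent_space \<A> p =
     {\<omega>. (\<forall>X\<in>tangent_space \<A> p. \<forall>Y\<in>tangent_space \<A> p. \<omega> (\<lambda>f. X f + Y f) = \<omega> X + \<omega> Y) \<and>
         (\<forall>X\<in>tangent_space \<A> p. \<forall>r. \<omega> (\<lambda>f. r * X f) = r * \<omega> X) \<and>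
         (\<forall>X. X \<notin> tangent_space \<A> p \<longrightarrow> \<omega> X = 0)}"

definition differential ::
  "('a::{t2_space,second_countable_topology}, 'n::finite) chart set \<Rightarrow>
   ('a \<Rightarrow> real) \<Rightarrow> 'a \<Rightarrow> 'a cotangent" where
  "differential \<A> f p = (\<lambda>X. if X \<in> tangent_space \<A> p then X f else 0)"

definition push_forward ::
  "('a::{t2_space,second_countable_topology}, 'n::finite) chart set \<Rightarrow>
   ('a \<Rightarrow> 'a) \<Rightarrow> 'a \<Rightarrow> 'a tangent \<Rightarrow> 'a tangent" where
  "push_forward \<A> F p X = (\<lambda>f. if smooth_near \<A> (F p) f then X (f \<circ> F) else 0)"

definition pull_back ::
  "('a::{t2_space,second_countable_topology}, 'n::finite) chart set \<Rightarrow>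
   ('a \<Rightarrow> 'a) \<Rightarrow> 'a \<Rightarrow> 'a cotangent \<Rightarrow> 'a cotangent" where
  "pull_back \<A> F p \<omega> =
     (\<lambda>X. if X \<in> tangent_space \<A> p then \<omega> (push_forward \<A> F p X) else 0)"


subsection \<open>Subriemannian structures and volume forms\<close>

definition subriemannian ::
  "('a::{t2_space,second_countable_topology}, 'n::finite) chart set \<Rightarrow>
   ('a \<Rightarrow> 'a cotangent \<Rightarrow> 'a cotangent \<Rightarrow> real) \<Rightarrow> bool" where
  "subriemannian \<A> g \<longleftrightarrow>
     (\<forall>p. \<forall>\<omega>\<in>cotangent_space \<A> p. \<forall>\<eta>\<in>cotangent_space \<A> p.
        (\<forall>\<zeta>\<in>cotangent_space \<A> p. g p (\<lambda>X. \<omega> X + \<eta> X) \<zeta> = g p \<omega> \<zeta> + g p \<eta> \<zeta>) \<and>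
        (\<forall>r. g p (\<lambda>X. r * \<omega> X) \<eta> = r * g p \<omega> \<eta>) \<and>
        g p \<omega> \<eta> = g p \<eta> \<omega> \<and> g p \<omega> \<omega> \<ge> 0) \<and>
     (\<forall>(V, \<phi>)\<in>\<A>. \<forall>i j. smooth_fun \<A> V
        (\<lambda>q. g q (differential \<A> (\<lambda>x. \<phi> x $ i) q) (differential \<A> (\<lambda>x. \<phi> x $ j) q)))"

text \<open>
  Forms of top degree: their arguments are families of tangent vectors indexed by \<open>'n\<close>, the
  index type of the coordinates.
\<close>

type_synonym ('a, 'n) top_form = "'a \<Rightarrow> ('n \<Rightarrow> 'a tangent) \<Rightarrow> real"

definition alternating_form ::
  "('a::{t2_space,second_countable_topology}, 'n::finite) chart set \<Rightarrow> 'a \<Rightarrow>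
   (('n \<Rightarrow> 'a tangent) \<Rightarrow> real) \<Rightarrow> bool" where
  "alternating_form \<A> p \<alpha> \<longleftrightarrow>
     (\<forall>X \<in> UNIV \<rightarrow> tangent_space \<A> p.
        (\<forall>i. \<forall>Y\<in>tangent_space \<A> p. \<alpha> (X(i := (\<lambda>f. X i f + Y f))) = \<alpha> X + \<alpha> (X(i := Y))) \<and>
        (\<forall>i r. \<alpha> (X(i := (\<lambda>f. r * X i f))) = r * \<alpha> X) \<and>
        (\<forall>i j. i \<noteq> j \<and> X i = X j \<longrightarrow> \<alpha> X = 0))"

definition coordinate_vector ::
  "('a::{t2_space,second_countable_topology}, 'n::finite) chart set \<Rightarrow>
   'a set \<Rightarrow> ('a \<Rightarrow> real^'n) \<Rightarrow> 'n \<Rightarrow> 'a \<Rightarrow> 'a tangent" where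
  "coordinate_vector \<A> V \<phi> i q = velocity \<A> (\<lambda>t. inv_into V \<phi> (\<phi> q + t *\<^sub>R axis i 1))"

definition volume_form ::
  "('a::{t2_space,second_countable_topology}, 'n::finite) chart set \<Rightarrow>
   ('a, 'n) top_form \<Rightarrow> bool" where
  "volume_form \<A> dv \<longleftrightarrow>
     (\<forall>p. alternating_form \<A> p (dv p)) \<and>
     (\<forall>(V, \<phi>)\<in>\<A>. smooth_fun \<A> V (\<lambda>q. dv q (\<lambda>i. coordinate_vector \<A> V \<phi> i q))) \<and>
     (\<forall>p. \<exists>X \<in> UNIV \<rightarrow> tangent_space \<A> p. dv p X \<noteq> 0)"

text \<open>
  The form \<open>dx\<^sup>1 \<and> \<dots> \<and> dx\<^sup>n\<close> of a chart; the determinant does not depend on the order in which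
  rows and columns are simultaneously enumerated.
\<close>

definition coordinate_form ::
  "('a::{t2_space,second_countable_topology}, 'n::finite) chart set \<Rightarrow>
   ('a \<Rightarrow> real^'n) \<Rightarrow> ('a, 'n) top_form" where
  "coordinate_form \<A> \<phi> q X = det (\<chi> i j. differential \<A> (\<lambda>x. \<phi> x $ i) q (X j))"


subsection \<open>Hypersurfaces and isometric translations\<close>

definition hypersurface ::
  "('a::{t2_space,second_countable_topology}, 'n::finite) chart set \<Rightarrow> 'a set \<Rightarrow> bool" where
  "hypersurface \<A> S \<longleftrightarrow>
     (\<forall>p\<in>S. \<exists>(V, \<phi>)\<in>\<A>. p \<in> V \<and> (\<exists>k. S \<inter> V = {q\<in>V. \<phi> q $ k = 0}))"

definition tangent_space_of ::
  "('a::{t2_space,second_countable_topology}, 'n::finite) chart set \<Rightarrow>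
   'a set \<Rightarrow> 'a \<Rightarrow> 'a tangent set" where
  "tangent_space_of \<A> S p =
     {velocity \<A> \<gamma> |\<gamma>. \<gamma> 0 = p \<and>
        (\<exists>e>0. smooth_curve \<A> {-e<..<e} \<gamma> \<and> \<gamma> ` {-e<..<e} \<subseteq> S)}"

text \<open>
  \<open>\<Psi> a q\<close> is meaningful for \<open>\<bar>a\<bar> < \<delta>\<close> and \<open>q \<in> U\<close> only, and may leave \<open>U\<close>; the composition
  \<open>\<Psi> a (\<Psi> b q)\<close> is defined iff \<open>\<Psi> b q \<in> U\<close>.
\<close>

definition isometric_translations ::
  "('a::{t2_space,second_countable_topology}, 'n::finite) chart set \<Rightarrow>
   ('a \<Rightarrow> 'a cotangent \<Rightarrow> 'a cotangent \<Rightarrow> real) \<Rightarrow> ('a, 'n) top_form \<Rightarrow>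
   'a \<Rightarrow> 'a set \<Rightarrow> real \<Rightarrow> (real \<Rightarrow> 'a \<Rightarrow> 'a) \<Rightarrow> bool" where
  "isometric_translations \<A> g dv p0 U \<delta> \<Psi> \<longleftrightarrow>
     open U \<and> p0 \<in> U \<and> \<delta> > 0 \<and>
     smooth_family \<A> {-\<delta><..<\<delta>} U \<Psi> \<and>
     (\<forall>a\<in>{-\<delta><..<\<delta>}. local_diffeo \<A> U (\<Psi> a)) \<and>
     (\<forall>q\<in>U. \<Psi> 0 q = q) \<and>
     (\<forall>a\<in>{-\<delta><..<\<delta>}. \<forall>b\<in>{-\<delta><..<\<delta>}. \<forall>q\<in>U.
        a + b \<in> {-\<delta><..<\<delta>} \<and> \<Psi> b q \<in> U \<longrightarrow> \<Psi> (a + b) q = \<Psi> a (\<Psi> b q)) \<and>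
     (\<forall>a\<in>{-\<delta><..<\<delta>}. \<forall>q\<in>U. \<Psi> a q \<in> U \<longrightarrow>
        (\<forall>\<omega>\<in>cotangent_space \<A> (\<Psi> a q). \<forall>\<eta>\<in>cotangent_space \<A> (\<Psi> a q).
           g q (pull_back \<A> (\<Psi> a) q \<omega>) (pull_back \<A> (\<Psi> a) q \<eta>) = g (\<Psi> a q) \<omega> \<eta>)) \<and>
     (\<forall>a\<in>{-\<delta><..<\<delta>}. \<forall>q\<in>U. \<Psi> a q \<in> U \<longrightarrow>
        (\<forall>X \<in> UNIV \<rightarrow> tangent_space \<A> q.
           dv (\<Psi> a q) (\<lambda>i. push_forward \<A> (\<Psi> a) q (X i)) = dv q X))"

definition transversal ::
  "('a::{t2_space,second_countable_topology}, 'n::finite) chart set \<Rightarrow>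
   'a set \<Rightarrow> (real \<Rightarrow> 'a \<Rightarrow> 'a) \<Rightarrow> 'a set \<Rightarrow> bool" where
  "transversal \<A> U \<Psi> S \<longleftrightarrow>
     (\<forall>q\<in>S \<inter> U. velocity \<A> (\<lambda>a. \<Psi> a q) \<notin> tangent_space_of \<A> S q)"

end

(* Write \<phi> for a chart around p0 in which S is the hyperplane y_k = 0. The flow box map
   F(y) = \<phi> (\<Psi>_t (s)), where t is the last coordinate of y and s is the point of S whose remaining
   chart coordinates are the other coordinates of y, has an invertible derivative at 0 because the
   velocity of the translations has a nonzero k-th component. The coordinates are x = F^-1 \<circ> \<phi>: by
   the group law, \<Psi>_a adds a to the last one and fixes the others. So \<Psi>_a pushes the coordinate
   vectors at q to those at \<Psi>_a(q), and invariance of dv is invariance of its value on them. *)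

theory Submission
  imports Defs
begin

section \<open>Differential calculus of smooth maps\<close>

text \<open>Local coordinates are the members of the maximal atlas, so \<open>x\<close> needs smooth
  transition maps in both directions. This takes an inverse function theorem for smooth maps, drawn
  here from the C^1 theorem by a calculus for \<open>smooth_on\<close>. Tangent vectors are
  operators on functions, so computations with them pass through \<open>coord_tangent\<close>, the
  vector with given components in a chart. Let X be the velocity of the translations at p0, read in
  the chart \<phi>. If its k-th component were zero, the straight line through \<phi>(p0) in
  direction X would stay in S and have the same velocity, against transversality. The derivative of
  F at 0 sends v to v_l X + P v, where P v has k-th component zero and carries all components of v
  except v_l; hence its kernel is trivial. That A is determined by the values of dv on coordinate
  vectors rests on the fact that an alternating multilinear function of n vectors is a multiple of
  the determinant; this is proved by factoring a matrix into elementary ones.\<close>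

lemma k_times_differentiable_on_subset:
  "k_times_differentiable_on k S f \<Longrightarrow> T \<subseteq> S \<Longrightarrow> k_times_differentiable_on k T f"
  by (induction k arbitrary: f) (auto intro: continuous_on_subset)

text \<open>Openness of \<open>S\<close> lets the equality of \<open>f\<close> and \<open>g\<close>
  pass to their derivatives, which depend on a full neighbourhood of each point.\<close>

lemma k_times_differentiable_on_cong:
  assumes "open S" "k_times_differentiable_on k S f" "\<And>x. x \<in> S \<Longrightarrow> f x = g x"
  shows "k_times_differentiable_on k S g"
  using assms(2,3)
proof (induction k arbitrary: f g)
  case 0
  then show ?case by (simp cong: continuous_on_cong)
next
  case (Suc k)
  have fg: "(g has_derivative frechet_derivative f (at x)) (at x)" if "x \<in> S" for x
  proof (rule has_derivative_transform_within_open[OF _ \<open>open S\<close> that])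
    show "(f has_derivative frechet_derivative f (at x)) (at x)"
      using Suc.prems that by (simp add: frechet_derivative_works)
  qed (use Suc.prems in simp)
  moreover have "k_times_differentiable_on k S (\<lambda>x. frechet_derivative g (at x) v)" for v
  proof (rule Suc.IH)
    show "k_times_differentiable_on k S (\<lambda>x. frechet_derivative f (at x) v)"
      using Suc.prems by simp
    show "frechet_derivative f (at x) v = frechet_derivative g (at x) v" if "x \<in> S" for x
      using frechet_derivative_at[OF fg[OF that]] by simp
  qed
  ultimately show ?case
    by (auto simp: differentiable_def)
qed

text \<open>Allows an explicit formula for the derivative in place of
  \<open>frechet_derivative\<close>; each differentiation rule below enters through it.\<close>

lemma k_times_differentiable_on_SucI:
  assumes "open S" "\<And>x. x \<in> S \<Longrightarrow> (f has_derivative f' x) (at x)"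
    and "\<And>v. k_times_differentiable_on k S (\<lambda>x. f' x v)"
  shows "k_times_differentiable_on (Suc k) S f"
proof -
  have "k_times_differentiable_on k S (\<lambda>x. frechet_derivative f (at x) v)" for v
    by (rule k_times_differentiable_on_cong[OF assms(1) assms(3)[of v]])
      (simp add: frechet_derivative_at[OF assms(2), symmetric])
  then show ?thesis
    using assms(2) by (auto simp: differentiable_def)
qed

lemma k_times_differentiable_on_SucD:
  assumes "k_times_differentiable_on (Suc k) S f"
  shows "x \<in> S \<Longrightarrow> (f has_derivative frechet_derivative f (at x)) (at x)"
    and "k_times_differentiable_on k S (\<lambda>x. frechet_derivative f (at x) v)"
  using assms by (auto simp: frechet_derivative_works)

text \<open>In the product and chain rules undifferentiated functions stand beside derivatives; this
  brings both to the same order, as the induction hypotheses require.\<close>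

lemma k_times_differentiable_on_Suc_imp:
  "k_times_differentiable_on (Suc k) S f \<Longrightarrow> k_times_differentiable_on k S f"
proof (induction k arbitrary: f)
  case 0
  then show ?case
    by (auto intro!: continuous_at_imp_continuous_on differentiable_imp_continuous_within)
next
  case (Suc k)
  have "(\<forall>x\<in>S. f differentiable at x) \<and>
      (\<forall>v. k_times_differentiable_on (Suc k) S (\<lambda>x. frechet_derivative f (at x) v))"
    using Suc.prems by (subst (asm) k_times_differentiable_on.simps(2))
  with Suc.IH show ?case
    by (subst k_times_differentiable_on.simps(2)) blast
qed

lemma k_times_differentiable_on_imp_continuous_on:
  "k_times_differentiable_on k S f \<Longrightarrow> continuous_on S f"
  by (cases k) (auto intro!: continuous_at_imp_continuous_on differentiable_imp_continuous_within)

lemma k_times_differentiable_on_bounded_linear: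
  assumes "bounded_linear L" "open S" "k_times_differentiable_on k S f"
  shows "k_times_differentiable_on k S (\<lambda>x. L (f x))"
  using assms(3)
proof (induction k arbitrary: f)
  case 0
  then show ?case
    using assms(1) by (auto intro: bounded_linear.continuous_on)
next
  case (Suc k)
  note bounded_linear.has_derivative[OF assms(1) k_times_differentiable_on_SucD(1)[OF Suc.prems]]
  then show ?case
    by (rule k_times_differentiable_on_SucI[OF \<open>open S\<close>])
      (assumption | intro Suc.IH k_times_differentiable_on_SucD(2)[OF Suc.prems])+
qed

lemma k_times_differentiable_on_const: "k_times_differentiable_on k S (\<lambda>x. c)"
  by (induction k arbitrary: c) auto

lemma k_times_differentiable_on_add:
  assumes "open S" "k_times_differentiable_on k S f" "k_times_differentiable_on k S g"
  shows "k_times_differentiable_on k S (\<lambda>x. f x + g x)"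
  using assms(2,3)
proof (induction k arbitrary: f g)
  case 0
  then show ?case by (auto intro: continuous_on_add)
next
  case (Suc k)
  note has_derivative_add[OF k_times_differentiable_on_SucD(1)[OF Suc.prems(1)]
      k_times_differentiable_on_SucD(1)[OF Suc.prems(2)]]
  then show ?case
    by (rule k_times_differentiable_on_SucI[OF \<open>open S\<close>])
      (assumption | intro Suc.IH k_times_differentiable_on_SucD(2) Suc.prems)+
qed

lemma k_times_differentiable_on_sum:
  assumes "open S" "\<And>i. i \<in> I \<Longrightarrow> k_times_differentiable_on k S (f i)"
  shows "k_times_differentiable_on k S (\<lambda>x. \<Sum>i\<in>I. f i x)"
  using assms(2)
  by (induction I rule: infinite_finite_induct)
    (auto intro!: k_times_differentiable_on_const k_times_differentiable_on_add assms(1))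

text \<open>Stated for any bounded bilinear map, to cover products of reals and scalar multiples at
  once.\<close>

lemma k_times_differentiable_on_bilinear:
  assumes "bounded_bilinear B" "open S"
    and "k_times_differentiable_on k S f" "k_times_differentiable_on k S g"
  shows "k_times_differentiable_on k S (\<lambda>x. B (f x) (g x))"
  using assms(3,4)
proof (induction k arbitrary: f g)
  case 0
  then show ?case by (auto intro: bounded_bilinear.continuous_on[OF assms(1)])
next
  case (Suc k)
  have "k_times_differentiable_on k S
      (\<lambda>x. B (f x) (frechet_derivative g (at x) v) + B (frechet_derivative f (at x) v) (g x))" for v
    by (intro k_times_differentiable_on_add[OF \<open>open S\<close>] Suc.IH k_times_differentiable_on_SucD(2)
        Suc.prems Suc.prems[THEN k_times_differentiable_on_Suc_imp])
  with bounded_bilinear.FDERIV[OF assms(1) k_times_differentiable_on_SucD(1)[OF Suc.prems(1)]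
      k_times_differentiable_on_SucD(1)[OF Suc.prems(2)]]
  show ?case
    by (rule k_times_differentiable_on_SucI[OF \<open>open S\<close>])
qed

text \<open>The definition controls derivatives in fixed directions only, but the chain rule
  evaluates the derivative of \<open>g\<close> in the moving direction \<open>?f' x v\<close>.
  Expanding this vector in a basis of the middle space leaves a finite sum of products with fixed
  directions, hence the class \<open>euclidean_space\<close>.\<close>

lemma k_times_differentiable_on_compose:
  fixes f :: "'a::real_normed_vector \<Rightarrow> 'b::euclidean_space" and g :: "'b \<Rightarrow> 'c::real_normed_vector"
  assumes "open S" "k_times_differentiable_on k T g" "k_times_differentiable_on k S f" "f ` S \<subseteq> T"
  shows "k_times_differentiable_on k S (\<lambda>x. g (f x))"
  using assms(2,3)
proof (induction k arbitrary: g)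
  case 0
  then show ?case
    using assms(4) by (auto intro: continuous_on_compose2)
next
  case (Suc k)
  let ?f' = "\<lambda>x. frechet_derivative f (at x)" and ?g' = "\<lambda>y. frechet_derivative g (at y)"
  have der: "((\<lambda>x. g (f x)) has_derivative (\<lambda>v. \<Sum>b\<in>Basis. (?f' x v \<bullet> b) *\<^sub>R ?g' (f x) b)) (at x)"
    if "x \<in> S" for x
  proof -
    have f: "(f has_derivative ?f' x) (at x)"
      by (rule k_times_differentiable_on_SucD(1)[OF Suc.prems(2) that])
    have g: "(g has_derivative ?g' (f x)) (at (f x))"
      by (rule k_times_differentiable_on_SucD(1)[OF Suc.prems(1)]) (use that assms(4) in blast)
    have "?g' (f x) w = (\<Sum>b\<in>Basis. (w \<bullet> b) *\<^sub>R ?g' (f x) b)" for w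
    proof -
      have lin: "linear (?g' (f x))"
        using g by (rule has_derivative_linear)
      have "?g' (f x) (\<Sum>b\<in>Basis. (w \<bullet> b) *\<^sub>R b) = (\<Sum>b\<in>Basis. (w \<bullet> b) *\<^sub>R ?g' (f x) b)"
        unfolding linear_sum[OF lin] linear_cmul[OF lin] ..
      then show ?thesis
        unfolding euclidean_representation .
    qed
    then have eq: "?g' (f x) \<circ> ?f' x = (\<lambda>v. \<Sum>b\<in>Basis. (?f' x v \<bullet> b) *\<^sub>R ?g' (f x) b)"
      unfolding o_def by (rule ext)
    show ?thesis
      using diff_chain_at[OF f g] unfolding eq unfolding o_def .
  qed
  have "k_times_differentiable_on k S (\<lambda>x. \<Sum>b\<in>Basis. (?f' x v \<bullet> b) *\<^sub>R ?g' (f x) b)" for v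
  proof (intro k_times_differentiable_on_sum[OF \<open>open S\<close>]
      k_times_differentiable_on_bilinear[OF bounded_bilinear_scaleR \<open>open S\<close>])
    fix b :: 'b
    show "k_times_differentiable_on k S (\<lambda>x. ?f' x v \<bullet> b)"
      by (rule k_times_differentiable_on_bounded_linear[OF bounded_linear_inner_left \<open>open S\<close>
            k_times_differentiable_on_SucD(2)[OF Suc.prems(2)]])
    show "k_times_differentiable_on k S (\<lambda>x. ?g' (f x) b)"
      by (rule Suc.IH[OF k_times_differentiable_on_SucD(2)[OF Suc.prems(1)]
            k_times_differentiable_on_Suc_imp[OF Suc.prems(2)]])
  qed
  note * = this
  show ?case
    by (rule k_times_differentiable_on_SucI[OF \<open>open S\<close>], erule der, rule *)
qed

text \<open>The derivative of 1/f is a product of f' with two factors 1/f, so regularity of 1/f at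
  one order yields the next.\<close>

lemma k_times_differentiable_on_inverse:
  fixes f :: "'a::real_normed_vector \<Rightarrow> real"
  assumes "open S" "k_times_differentiable_on k S f" "\<And>x. x \<in> S \<Longrightarrow> f x \<noteq> 0"
  shows "k_times_differentiable_on k S (\<lambda>x. inverse (f x))"
  using assms(2)
proof (induction k)
  case 0
  then show ?case using assms(3) by (auto intro: continuous_on_inverse)
next
  case (Suc k)
  have inv: "k_times_differentiable_on k S (\<lambda>x. inverse (f x))"
    using Suc.IH k_times_differentiable_on_Suc_imp[OF Suc.prems] .
  have "k_times_differentiable_on k S
      (\<lambda>x. - (inverse (f x) * frechet_derivative f (at x) v * inverse (f x)))" for v
    by (intro k_times_differentiable_on_bounded_linear[OF bounded_linear_minus[OF bounded_linear_ident]]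
        k_times_differentiable_on_bilinear[OF bounded_bilinear_mult] \<open>open S\<close> inv
        k_times_differentiable_on_SucD(2)[OF Suc.prems])
  with Deriv.has_derivative_inverse[OF assms(3) k_times_differentiable_on_SucD(1)[OF Suc.prems]]
  show ?case
    by (rule k_times_differentiable_on_SucI[OF \<open>open S\<close>])
qed

section \<open>Smooth maps: closure under the operations of calculus\<close>

lemma smooth_on_subset: "smooth_on S f \<Longrightarrow> T \<subseteq> S \<Longrightarrow> smooth_on T f"
  by (auto simp: smooth_on_def intro: k_times_differentiable_on_subset)

lemma smooth_on_cong:
  assumes "open S" "smooth_on S f" "\<And>x. x \<in> S \<Longrightarrow> f x = g x"
  shows "smooth_on S g"
  using k_times_differentiable_on_cong[OF assms(1) _ assms(3)] assms(2) by (simp add: smooth_on_def)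

lemma smooth_on_imp_continuous_on: "smooth_on S f \<Longrightarrow> continuous_on S f"
  by (auto simp: smooth_on_def intro: k_times_differentiable_on_imp_continuous_on)

lemma smooth_on_has_derivative:
  assumes "smooth_on S f" "x \<in> S"
  shows "(f has_derivative frechet_derivative f (at x)) (at x)"
  by (rule k_times_differentiable_on_SucD(1)[OF _ assms(2)])
    (rule assms(1)[unfolded smooth_on_def, rule_format])

lemma smooth_on_frechet_derivative:
  assumes "smooth_on S f"
  shows "smooth_on S (\<lambda>x. frechet_derivative f (at x) v)"
  unfolding smooth_on_def
  by (intro allI k_times_differentiable_on_SucD(2) assms[unfolded smooth_on_def, rule_format])

lemma smooth_on_const: "smooth_on S (\<lambda>x. c)"
  by (simp add: smooth_on_def k_times_differentiable_on_const)

lemma smooth_on_bounded_linear_compose: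
  "bounded_linear L \<Longrightarrow> open S \<Longrightarrow> smooth_on S f \<Longrightarrow> smooth_on S (\<lambda>x. L (f x))"
  by (simp add: smooth_on_def k_times_differentiable_on_bounded_linear)

lemma smooth_on_ident:
  assumes "open S" shows "smooth_on S (\<lambda>x. x)"
  unfolding smooth_on_def
proof
  fix k show "k_times_differentiable_on k S (\<lambda>x. x)"
  proof (cases k)
    case (Suc j)
    show ?thesis
      unfolding Suc
      by (rule k_times_differentiable_on_SucI[OF assms has_derivative_ident])
        (rule k_times_differentiable_on_const)
  qed auto
qed

lemma smooth_on_bounded_linear: "bounded_linear L \<Longrightarrow> open S \<Longrightarrow> smooth_on S L"
  using smooth_on_bounded_linear_compose[OF _ _ smooth_on_ident] .

lemma smooth_on_add:
  "open S \<Longrightarrow> smooth_on S f \<Longrightarrow> smooth_on S g \<Longrightarrow> smooth_on S (\<lambda>x. f x + g x)"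
  by (simp add: smooth_on_def k_times_differentiable_on_add)

lemma smooth_on_sum:
  "open S \<Longrightarrow> (\<And>i. i \<in> I \<Longrightarrow> smooth_on S (f i)) \<Longrightarrow> smooth_on S (\<lambda>x. \<Sum>i\<in>I. f i x)"
  by (simp add: smooth_on_def k_times_differentiable_on_sum)

lemma smooth_on_scaleR:
  "open S \<Longrightarrow> smooth_on S f \<Longrightarrow> smooth_on S g \<Longrightarrow> smooth_on S (\<lambda>x. f x *\<^sub>R g x)"
  unfolding smooth_on_def
  by (intro allI k_times_differentiable_on_bilinear[OF bounded_bilinear_scaleR]) simp_all

lemma smooth_on_mult:
  fixes f g :: "_ \<Rightarrow> real"
  shows "open S \<Longrightarrow> smooth_on S f \<Longrightarrow> smooth_on S g \<Longrightarrow> smooth_on S (\<lambda>x. f x * g x)"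
  unfolding smooth_on_def
  by (intro allI k_times_differentiable_on_bilinear[OF bounded_bilinear_mult]) simp_all

lemma smooth_on_prod:
  fixes f :: "_ \<Rightarrow> _ \<Rightarrow> real"
  shows "open S \<Longrightarrow> (\<And>i. i \<in> I \<Longrightarrow> smooth_on S (f i)) \<Longrightarrow> smooth_on S (\<lambda>x. \<Prod>i\<in>I. f i x)"
  by (induction I rule: infinite_finite_induct) (auto intro: smooth_on_const smooth_on_mult)

lemma smooth_on_divide:
  fixes f g :: "_ \<Rightarrow> real"
  assumes "open S" "smooth_on S f" "smooth_on S g" "\<And>x. x \<in> S \<Longrightarrow> g x \<noteq> 0"
  shows "smooth_on S (\<lambda>x. f x / g x)"
  unfolding divide_inverse
proof (intro smooth_on_mult assms)
  show "smooth_on S (\<lambda>x. inverse (g x))"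
    unfolding smooth_on_def
    by (intro allI k_times_differentiable_on_inverse assms(1,4)
        assms(3)[unfolded smooth_on_def, rule_format])
qed

lemma smooth_on_compose:
  fixes f :: "'a::real_normed_vector \<Rightarrow> 'b::euclidean_space" and g :: "'b \<Rightarrow> 'c::real_normed_vector"
  assumes "open S" "smooth_on T g" "smooth_on S f" "f ` S \<subseteq> T"
  shows "smooth_on S (\<lambda>x. g (f x))"
  unfolding smooth_on_def
  by (rule allI, rule k_times_differentiable_on_compose[OF assms(1)
        assms(2,3)[unfolded smooth_on_def, rule_format] assms(4)])

lemma smooth_on_Pair:
  assumes "open S" "smooth_on S f" "smooth_on S g"
  shows "smooth_on S (\<lambda>x. (f x, g x))"
proof -
  have "smooth_on S (\<lambda>x. (f x, 0))"
    by (rule smooth_on_bounded_linear_compose[OF _ assms(1,2)])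
      (intro bounded_linear_Pair bounded_linear_ident bounded_linear_zero)
  moreover have "smooth_on S (\<lambda>x. (0, g x))"
    by (rule smooth_on_bounded_linear_compose[OF _ assms(1,3)])
      (intro bounded_linear_Pair bounded_linear_ident bounded_linear_zero)
  ultimately have "smooth_on S (\<lambda>x. (f x, 0) + (0, g x))"
    by (rule smooth_on_add[OF assms(1)])
  then show ?thesis by simp
qed

lemma smooth_on_vec_lambda:
  fixes f :: "'i::finite \<Rightarrow> 'a::real_normed_vector \<Rightarrow> real"
  assumes "open S" "\<And>i. smooth_on S (f i)"
  shows "smooth_on S (\<lambda>x. \<chi> i. f i x)"
proof -
  have "smooth_on S (\<lambda>x. \<Sum>i\<in>UNIV. f i x *\<^sub>R axis i (1::real))"
    by (intro smooth_on_sum smooth_on_scaleR smooth_on_const assms)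
  moreover have "(\<Sum>i\<in>UNIV. f i x *\<^sub>R axis i (1::real)) = (\<chi> i. f i x)" for x
    by (simp add: vec_eq_iff axis_def if_distrib cong: if_cong)
  ultimately show ?thesis by simp
qed

lemma smooth_on_vec_nth:
  fixes f :: "'a::real_normed_vector \<Rightarrow> real^'i"
  shows "open S \<Longrightarrow> smooth_on S f \<Longrightarrow> smooth_on S (\<lambda>x. f x $ i)"
  by (rule smooth_on_bounded_linear_compose[OF bounded_linear_vec_nth])

lemma smooth_on_det:
  fixes M :: "'a::real_normed_vector \<Rightarrow> real^'n^'n"
  assumes "open S" "\<And>i j. smooth_on S (\<lambda>x. M x $ i $ j)"
  shows "smooth_on S (\<lambda>x. det (M x))"
  unfolding det_def
  by (intro smooth_on_sum smooth_on_mult smooth_on_const smooth_on_prod assms)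


section \<open>The smooth inverse function theorem\<close>

text \<open>By Cramer's rule the derivative of the inverse map is a smooth function, namely a quotient of
  determinants, of the inverse map itself; so each order of differentiability gives the next one.\<close>

lemma smooth_on_inverse_map:
  fixes f g :: "real^'n \<Rightarrow> real^'n"
  assumes "open N'" "open N" "smooth_on N f" "\<And>z. z \<in> N' \<Longrightarrow> g z \<in> N"
    and g': "\<And>z. z \<in> N' \<Longrightarrow> (g has_derivative inv (frechet_derivative f (at (g z)))) (at z)"
    and bij: "\<And>y. y \<in> N \<Longrightarrow> bij (frechet_derivative f (at y))"
  shows "smooth_on N' g"
proof -
  define J where "J y = matrix (frechet_derivative f (at y))" for y
  define R where "R v y = (\<chi> k. det (\<chi> i j. if j = k then v $ i else J y $ i $ j) / det (J y))" for v y
  have lin: "linear (frechet_derivative f (at y))" if "y \<in> N" for y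
    using smooth_on_has_derivative[OF assms(3) that] by (rule has_derivative_linear)
  have J: "J y *v w = frechet_derivative f (at y) w" if "y \<in> N" for y w
    unfolding J_def by (rule fun_cong[OF matrix_vector_mul(2)[OF lin[OF that]]])
  have detJ: "det (J y) \<noteq> 0" if "y \<in> N" for y
    using bij[OF that] det_nz_iff_inj[OF lin[OF that]] by (simp add: J_def bij_is_inj)
  have R: "inv (frechet_derivative f (at y)) v = R v y" if "y \<in> N" for y v
  proof -
    have "J y *v R v y = v"
      unfolding R_def using cramer[OF detJ[OF that]] by blast
    then show ?thesis
      using J[OF that] bij_is_inj[OF bij[OF that]] by (metis inv_f_f)
  qed
  have Jsm: "smooth_on N (\<lambda>y. J y $ i $ j)" for i j
    unfolding J_def matrix_def
    using smooth_on_vec_nth[OF assms(2) smooth_on_frechet_derivative[OF assms(3)]] by simp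
  have Rsm: "smooth_on N (R v)" for v
    unfolding R_def
  proof (intro smooth_on_vec_lambda smooth_on_divide smooth_on_det assms(2) detJ Jsm)
    fix k i j
    show "smooth_on N (\<lambda>x. (\<chi> i j. if j = k then v $ i else J x $ i $ j) $ i $ j)"
      by (cases "j = k") (simp_all add: smooth_on_const Jsm)
  qed
  have "k_times_differentiable_on k N' g" for k
  proof (induction k)
    case 0
    show ?case
      using g' by (auto intro!: continuous_at_imp_continuous_on has_derivative_continuous)
  next
    case (Suc k)
    have "k_times_differentiable_on k N' (\<lambda>z. R v (g z))" for v
      by (rule k_times_differentiable_on_compose[OF assms(1) _ Suc.IH, of N])
        (use Rsm assms(4) in \<open>auto simp: smooth_on_def\<close>)
    then have *: "k_times_differentiable_on k N' (\<lambda>z. inv (frechet_derivative f (at (g z))) v)" for v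
      by (rule k_times_differentiable_on_cong[OF assms(1)]) (simp add: R assms(4))
    show ?case
      by (rule k_times_differentiable_on_SucI[OF assms(1) g' *])
  qed
  then show ?thesis by (simp add: smooth_on_def)
qed

lemma smooth_inverse_function_theorem:
  fixes f :: "real^'n \<Rightarrow> real^'n"
  assumes "open B" "smooth_on B f" "y0 \<in> B"
    and inj: "\<And>v. frechet_derivative f (at y0) v = 0 \<Longrightarrow> v = 0"
  obtains N N' g where "open N" "y0 \<in> N" "N \<subseteq> B" "open N'" "homeomorphism N N' f g" "smooth_on N' g"
proof -
  \<comment> \<open>The C^1 theorem takes the derivative as a map into the bounded linear
    operators.\<close>
  define f' where "f' y = Blinfun (frechet_derivative f (at y))" for y
  have bl: "bounded_linear (frechet_derivative f (at y))" if "y \<in> B" for y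
    using smooth_on_has_derivative[OF assms(2) that] by (rule has_derivative_bounded_linear)
  have f': "blinfun_apply (f' y) = frechet_derivative f (at y)" if "y \<in> B" for y
    unfolding f'_def by (rule bounded_linear_Blinfun_apply[OF bl[OF that]])
  have lin: "linear (frechet_derivative f (at y0))"
    by (rule bounded_linear.linear[OF bl[OF \<open>y0 \<in> B\<close>]])
  have "inj (frechet_derivative f (at y0))"
    unfolding linear_injective_0[OF lin] using inj by blast
  then obtain h where h: "linear h" "h \<circ> frechet_derivative f (at y0) = id"
    using linear_injective_left_inverse[OF lin] by blast
  have h0: "Blinfun h o\<^sub>L f' y0 = id_blinfun"
    using h f'[OF \<open>y0 \<in> B\<close>]
    by (intro blinfun_eqI)
      (simp add: bounded_linear_Blinfun_apply linear_conv_bounded_linear[symmetric] fun_eq_iff)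
  \<comment> \<open>In finite dimension, continuity in operator norm can be tested on single
    vectors, where it is part of smoothness.\<close>
  have cont: "continuous_on B f'"
  proof (rule continuous_on_blinfun_componentwise)
    fix i :: "real^'n"
    have "continuous_on B (\<lambda>y. frechet_derivative f (at y) i)"
      by (rule smooth_on_imp_continuous_on[OF smooth_on_frechet_derivative[OF assms(2)]])
    then show "continuous_on B (\<lambda>y. blinfun_apply (f' y) i)"
      by (rule continuous_on_eq) (simp add: f')
  qed
  have der: "(f has_derivative blinfun_apply (f' y)) (at y)" if "y \<in> B" for y
    using smooth_on_has_derivative[OF assms(2) that] by (simp add: f' that)
  obtain N N' g g' where N: "open N" "N \<subseteq> B" "y0 \<in> N" "open N'" "f y0 \<in> N'" "homeomorphism N N' f g"
    and g: "\<And>z. z \<in> N' \<Longrightarrow> (g has_derivative g' z) (at z)"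
      "\<And>z. z \<in> N' \<Longrightarrow> g' z = inv (blinfun_apply (f' (g z)))"
      "\<And>z. z \<in> N' \<Longrightarrow> bij (blinfun_apply (f' (g z)))"
    using inverse_function_theorem[OF assms(1) der cont assms(3) h0] by metis
  have gN: "g z \<in> N" "g z \<in> B" if "z \<in> N'" for z
    using N(2,6) that by (auto simp: homeomorphism_def)
  have "smooth_on N' g"
  proof (rule smooth_on_inverse_map[OF N(4,1) smooth_on_subset[OF assms(2) N(2)] gN(1)])
    show "(g has_derivative inv (frechet_derivative f (at (g z)))) (at z)" if "z \<in> N'" for z
      using g(1,2)[OF that] by (simp add: f' gN that)
    show "bij (frechet_derivative f (at y))" if "y \<in> N" for y
    proof -
      have "f y \<in> N'" "g (f y) = y" "y \<in> B"
        using N(2,6) that by (auto simp: homeomorphism_def)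
      then show ?thesis
        using g(3)[of "f y"] by (simp add: f')
    qed
  qed
  then show ?thesis
    using that N by blast
qed


section \<open>Alternating multilinear functions of matrix rows\<close>

text \<open>Left multiplication by an elementary matrix is a row operation, and \<open>D\<close>
  reacts to each row operation as the determinant does. The induction over elementary factors proves
  \<open>D (A ** B) = det A * D B\<close> for all \<open>B\<close>; the freedom in \<open>B\<close>
  is what carries the case of a product.\<close>

lemma alternating_eq_det:
  fixes D :: "real^'n^'n \<Rightarrow> real"
  assumes add: "\<And>A i r s. D (\<chi> k. if k = i then r + s else A $ k) =
      D (\<chi> k. if k = i then r else A $ k) + D (\<chi> k. if k = i then s else A $ k)"
    and scale: "\<And>A i c r. D (\<chi> k. if k = i then c *\<^sub>R r else A $ k) =
      c * D (\<chi> k. if k = i then r else A $ k)"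
    and alt: "\<And>A i j. i \<noteq> j \<Longrightarrow> A $ i = A $ j \<Longrightarrow> D A = 0"
  shows "D A = det A * D (mat 1)"
proof -
  have upd: "(\<chi> k. if k = i then B $ i else B $ k) = B" for B :: "real^'n^'n" and i
    by (simp add: vec_eq_iff)
  have zero: "D B = 0" if "B $ i = 0" for B i
    using scale[of i 0 0 B] upd[of i B] unfolding that scaleR_zero_left by simp
  have "\<forall>B. D (A ** B) = det A * D B"
  proof (induction A rule: induct_matrix_elementary_alt)
    case (1 A B)
    then show ?case by (simp add: det_mul matrix_mul_assoc[symmetric])
  next
    case zero_row: (2 A i)
    then have "A $ i = 0"
      by (simp add: row_def vec_eq_iff)
    then have "(A ** B) $ i = 0" for B :: "real^'n^'n"
      by (simp add: matrix_matrix_mult_def vec_eq_iff)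
    then show ?case
      using zero[of _ i] det_zero_row(2)[OF zero_row] by simp
  next
    case diagonal: (3 A)
    \<comment> \<open>Scale the rows one at a time; \<open>F\<close> is the set of rows already
      scaled.\<close>
    have "D (\<chi> k. if k \<in> F then A $ k $ k *\<^sub>R B $ k else B $ k) = (\<Prod>k\<in>F. A $ k $ k) * D B"
      for F B
    proof (induction F rule: infinite_finite_induct)
      case (insert i F)
      have "D (\<chi> k. if k \<in> insert i F then A $ k $ k *\<^sub>R B $ k else B $ k) =
          D (\<chi> k. if k = i then A $ i $ i *\<^sub>R B $ i
            else (\<chi> k. if k \<in> F then A $ k $ k *\<^sub>R B $ k else B $ k) $ k)"
        by (rule arg_cong[where f = D]) (auto simp: vec_eq_iff)
      also have "\<dots> = A $ i $ i * D (\<chi> k. if k = i then B $ i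
            else (\<chi> k. if k \<in> F then A $ k $ k *\<^sub>R B $ k else B $ k) $ k)"
        by (rule scale)
      also have "(\<chi> k. if k = i then B $ i
            else (\<chi> k. if k \<in> F then A $ k $ k *\<^sub>R B $ k else B $ k) $ k) =
          (\<chi> k. if k \<in> F then A $ k $ k *\<^sub>R B $ k else B $ k)"
        using insert.hyps by (auto simp: vec_eq_iff)
      finally show ?case
        using insert by simp
    qed auto
    from this[of UNIV]
    have "D (\<chi> k. A $ k $ k *\<^sub>R B $ k) = det A * D B" for B
      using det_diagonal[of A] diagonal by simp
    moreover have "A ** B = (\<chi> k. A $ k $ k *\<^sub>R B $ k)" for B :: "real^'n^'n"
    proof -
      have "(\<Sum>j\<in>UNIV. A $ i $ j * B $ j $ l) = A $ i $ i * B $ i $ l" for i l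
        by (subst sum.remove[of _ i]) (auto simp: diagonal intro!: sum.neutral)
      then show ?thesis
        by (simp add: matrix_matrix_mult_def vec_eq_iff)
    qed
    ultimately show ?case by simp
  next
    case swap1: (4 m n)
    let ?P = "(\<chi> i j. mat 1 $ i $ Transposition.transpose m n j) :: real^'n^'n"
    have "?P ** B = (\<chi> k. B $ Transposition.transpose m n k)" for B :: "real^'n^'n"
    proof -
      have "(\<Sum>j\<in>UNIV. mat 1 $ i $ Transposition.transpose m n j * B $ j $ l) =
          B $ Transposition.transpose m n i $ l" for i l
        by (subst sum.remove[of _ "Transposition.transpose m n i"])
          (auto simp: mat_def intro!: sum.neutral split: if_splits)
      then show ?thesis
        by (simp add: matrix_matrix_mult_def vec_eq_iff)
    qed
    moreover have "det ?P = -1"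
      using det_permute_columns[OF permutes_swap_id[of m UNIV n], of "mat 1 :: real^'n^'n"] swap1
      by (simp add: sign_swap_id)
    moreover have "D (\<chi> k. B $ Transposition.transpose m n k) = - D B" for B
    proof -
      \<comment> \<open>The rows \<open>m\<close> and \<open>n\<close> become variables.
        \<open>E\<close> is biadditive and vanishes on equal arguments, so expanding
        \<open>E (r + s) (r + s) = 0\<close> gives antisymmetry.\<close>
      define E where "E r s = D (\<chi> k. if k = m then r else if k = n then s else B $ k)" for r s
      have E2: "E r s = D (\<chi> k. if k = n then s else if k = m then r else B $ k)" for r s
        unfolding E_def using swap1 by (intro arg_cong[where f = D]) (auto simp: vec_eq_iff)
      have "E (r + r') s = E r s + E r' s" for r r' s
        unfolding E_def using add[of m r r' "\<chi> k. if k = n then s else B $ k"] by (simp cong: if_cong)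
      moreover have "E r (s + s') = E r s + E r s'" for r s s'
        unfolding E2 using add[of n s s' "\<chi> k. if k = m then r else B $ k"] by (simp cong: if_cong)
      moreover have "E r r = 0" for r
        unfolding E_def by (rule alt[OF swap1]) (use swap1 in simp)
      ultimately have "E (B $ n) (B $ m) = - E (B $ m) (B $ n)"
        by (metis add.inverse_inverse add.right_neutral add_0 eq_neg_iff_add_eq_0)
      moreover have "E (B $ n) (B $ m) = D (\<chi> k. B $ Transposition.transpose m n k)"
        unfolding E_def
        by (intro arg_cong[where f = D]) (auto simp: vec_eq_iff Transposition.transpose_def)
      moreover have "E (B $ m) (B $ n) = D B"
        unfolding E_def by (intro arg_cong[where f = D]) (auto simp: vec_eq_iff)
      ultimately show ?thesis by simp
    qed
    ultimately show ?case by simp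
  next
    case idplus: (5 m n)
    let ?P = "(\<chi> i j. of_bool (i = m \<and> j = n \<or> i = j)) :: real^'n^'n"
    have P: "?P ** B = (\<chi> k. if k = m then B $ m + B $ n else B $ k)" for B :: "real^'n^'n"
    proof -
      have "(\<Sum>j\<in>UNIV. of_bool (i = m \<and> j = n \<or> i = j) * B $ j $ l) =
          (if i = m then B $ m + B $ n else B $ i) $ l" for i l
      proof -
        have "(\<Sum>j\<in>UNIV. of_bool (i = m \<and> j = n \<or> i = j) * B $ j $ l) =
          (\<Sum>j\<in>UNIV. (if j = n then of_bool (i = m) * B $ n $ l else 0) + (if j = i then B $ i $ l else 0))"
          using idplus by (intro sum.cong) auto
        then show ?thesis
          by (auto simp: sum.distrib)
      qed
      then show ?thesis
        by (simp add: matrix_matrix_mult_def vec_eq_iff)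
    qed
    \<comment> \<open>Additivity in row \<open>m\<close> splits off a matrix whose rows
      \<open>m\<close> and \<open>n\<close> coincide, on which \<open>D\<close> vanishes.\<close>
    have "D (?P ** B) = D B" for B
      unfolding P add upd using alt[OF idplus, of "\<chi> k. if k = m then B $ n else B $ k"] idplus
      by simp
    moreover have "det ?P = 1"
    proof -
      have "?P = (\<chi> k. if k = m then row m (mat 1) + 1 *s row n (mat 1) else row k (mat 1))"
        using idplus by (auto simp: vec_eq_iff row_def mat_def)
      then show ?thesis
        using det_row_operation[OF idplus, of "mat 1 :: real^'n^'n" 1] by simp
    qed
    ultimately show ?case by simp
  qed
  from this[rule_format, of "mat 1"] show ?thesis by simp
qed


section \<open>Charts and tangent vectors\<close>

text \<open>The vector usually written as the sum of c_i d/dx^i at \<open>p\<close>. The default 0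
  repeats that of \<open>velocity\<close>, so that the two can be equal as operators on all
  functions.\<close>

definition coord_tangent ::
  "('a::{t2_space,second_countable_topology}, 'n::finite) chart set \<Rightarrow>
   'a set \<Rightarrow> ('a \<Rightarrow> real^'n) \<Rightarrow> 'a \<Rightarrow> real^'n \<Rightarrow> 'a tangent" where
  "coord_tangent \<A> V \<phi> p c = (\<lambda>f. if smooth_near \<A> p f
     then frechet_derivative (f \<circ> inv_into V \<phi>) (at (\<phi> p)) c else 0)"

locale smooth_manifold =
  fixes \<A> :: "('a::{t2_space,second_countable_topology}, 'n::finite) chart set"
  assumes smooth_structure: "smooth_structure \<A>"
begin

section \<open>Charts and the transfer of smoothness between them\<close>

lemma chartD:
  assumes "(V, \<phi>) \<in> \<A>"
  shows "open V" "open (\<phi> ` V)" "inj_on \<phi> V" "homeomorphism V (\<phi> ` V) \<phi> (inv_into V \<phi>)"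
    "continuous_on V \<phi>" "continuous_on (\<phi> ` V) (inv_into V \<phi>)"
proof -
  have "\<forall>(V, \<phi>)\<in>\<A>. is_chart V \<phi>"
    using smooth_structure by (simp add: smooth_structure_def)
  from bspec[OF this assms] have "is_chart V \<phi>"
    by simp
  then show "open V" "open (\<phi> ` V)" "inj_on \<phi> V" "homeomorphism V (\<phi> ` V) \<phi> (inv_into V \<phi>)"
    "continuous_on V \<phi>" "continuous_on (\<phi> ` V) (inv_into V \<phi>)"
    by (auto simp: is_chart_def homeomorphism_def)
qed

lemma chart_inv: "(V, \<phi>) \<in> \<A> \<Longrightarrow> q \<in> V \<Longrightarrow> inv_into V \<phi> (\<phi> q) = q"
  using chartD(3) by (simp add: inv_into_f_f)

lemma chart_image_open:
  assumes "(V, \<phi>) \<in> \<A>" "open N" "N \<subseteq> V"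
  shows "open (\<phi> ` N)"
proof -
  have "openin (top_of_set (\<phi> ` V)) (\<phi> ` N)"
    by (rule homeomorphism_imp_open_map[OF chartD(4)[OF assms(1)]])
      (use assms in \<open>simp add: openin_open_eq[OF chartD(1)[OF assms(1)]]\<close>)
  then show ?thesis
    using chartD(2)[OF assms(1)] openin_open_trans by blast
qed

lemma chart_vimage_open:
  assumes "(V, \<phi>) \<in> \<A>" "open O'"
  shows "open {q \<in> V. \<phi> q \<in> O'}"
  using continuous_open_preimage[OF chartD(5,1)[OF assms(1)] assms(2)]
  by (simp add: vimage_def Int_def)

lemma chart_inv_vimage_open:
  assumes "(V, \<phi>) \<in> \<A>" "open N"
  shows "open {y \<in> \<phi> ` V. inv_into V \<phi> y \<in> N}"
  using continuous_open_preimage[OF chartD(6,2)[OF assms(1)] assms(2)]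
  by (simp add: vimage_def Int_def)

lemma transition_smooth:
  assumes "(V, \<phi>) \<in> \<A>" "(W, \<psi>) \<in> \<A>"
  shows "smooth_on (\<phi> ` (V \<inter> W)) (\<psi> \<circ> inv_into V \<phi>)"
proof -
  have "\<forall>(V, \<phi>)\<in>\<A>. \<forall>(W, \<psi>)\<in>\<A>. smoothly_compatible V \<phi> W \<psi>"
    using smooth_structure by (simp add: smooth_structure_def)
  from bspec[OF bspec[OF this assms(1), unfolded prod.case] assms(2)] show ?thesis
    by (simp add: smoothly_compatible_def)
qed

text \<open>\<open>smooth_fun\<close> quantifies over all charts; the transition maps spread
  smoothness from the one chart where it is known. \<open>smooth_curveI\<close> does the same for
  curves.\<close>

lemma smooth_nearI:
  assumes V: "(V, \<phi>) \<in> \<A>" and N: "open N" "N \<subseteq> V" "p \<in> N"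
    and f: "smooth_on (\<phi> ` N) (f \<circ> inv_into V \<phi>)"
  shows "smooth_near \<A> p f"
proof -
  have "smooth_on (\<psi> ` (W \<inter> N)) (f \<circ> inv_into W \<psi>)" if W: "(W, \<psi>) \<in> \<A>" for W \<psi>
  proof -
  have op: "open (\<psi> ` (W \<inter> N))"
    using chart_image_open[OF W] chartD(1)[OF W] N by blast
  have "smooth_on (\<psi> ` (W \<inter> N)) (\<lambda>z. (f \<circ> inv_into V \<phi>) ((\<phi> \<circ> inv_into W \<psi>) z))"
  proof (rule smooth_on_compose[OF op f])
    show "smooth_on (\<psi> ` (W \<inter> N)) (\<phi> \<circ> inv_into W \<psi>)"
      by (rule smooth_on_subset[OF transition_smooth[OF W V]]) (use N in auto)
    show "(\<phi> \<circ> inv_into W \<psi>) ` \<psi> ` (W \<inter> N) \<subseteq> \<phi> ` N"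
      using chart_inv[OF W] by auto
  qed
  then show ?thesis
    by (rule smooth_on_cong[OF op]) (use chart_inv[OF W] chart_inv[OF V] N in auto)
  qed
  then show ?thesis
    using N unfolding smooth_near_def smooth_fun_def by blast
qed

lemma smooth_nearE:
  assumes "smooth_near \<A> p f" "(V, \<phi>) \<in> \<A>" "p \<in> V"
  obtains N where "open N" "N \<subseteq> V" "p \<in> N" "smooth_on (\<phi> ` N) (f \<circ> inv_into V \<phi>)"
proof -
  obtain U where "open U" "p \<in> U" "smooth_fun \<A> U f"
    using assms(1) unfolding smooth_near_def by blast
  then show ?thesis
    using that[of "V \<inter> U"] assms chartD(1)[OF assms(2)] unfolding smooth_fun_def by auto
qed

lemma smooth_near_has_derivative:
  assumes "smooth_near \<A> p f" "(V, \<phi>) \<in> \<A>" "p \<in> V"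
  shows "((f \<circ> inv_into V \<phi>) has_derivative frechet_derivative (f \<circ> inv_into V \<phi>) (at (\<phi> p))) (at (\<phi> p))"
proof -
  obtain N where "p \<in> N" "smooth_on (\<phi> ` N) (f \<circ> inv_into V \<phi>)"
    using smooth_nearE[OF assms] .
  then show ?thesis
    by (intro smooth_on_has_derivative[of "\<phi> ` N"] imageI)
qed

lemma smooth_curveI:
  assumes V: "(V, \<phi>) \<in> \<A>" and I: "open I" "\<gamma> ` I \<subseteq> V" "smooth_on I (\<phi> \<circ> \<gamma>)"
  shows "smooth_curve \<A> I \<gamma>"
  unfolding smooth_curve_def
proof
  have "continuous_on I (\<lambda>t. inv_into V \<phi> ((\<phi> \<circ> \<gamma>) t))"
    by (rule continuous_on_compose2[OF chartD(6)[OF V] smooth_on_imp_continuous_on[OF I(3)]])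
      (use I(2) in auto)
  then show cont: "continuous_on I \<gamma>"
    by (rule continuous_on_eq) (use I(2) chart_inv[OF V] in auto)
  show "\<forall>(W, \<psi>)\<in>\<A>. smooth_on {t \<in> I. \<gamma> t \<in> W} (\<psi> \<circ> \<gamma>)"
  proof clarify
    fix W \<psi> assume W: "(W, \<psi>) \<in> \<A>"
    have op: "open {t \<in> I. \<gamma> t \<in> W}"
      using continuous_open_preimage[OF cont I(1) chartD(1)[OF W]] by (simp add: vimage_def Int_def)
    have "smooth_on {t \<in> I. \<gamma> t \<in> W} (\<lambda>t. (\<psi> \<circ> inv_into V \<phi>) ((\<phi> \<circ> \<gamma>) t))"
      by (rule smooth_on_compose[OF op transition_smooth[OF V W] smooth_on_subset[OF I(3)]])
        (use I(2) in auto)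
    then show "smooth_on {t \<in> I. \<gamma> t \<in> W} (\<psi> \<circ> \<gamma>)"
      by (rule smooth_on_cong[OF op]) (use I(2) chart_inv[OF V] in auto)
  qed
qed

section \<open>Tangent vectors and top forms in coordinates\<close>

lemma smooth_curve_has_derivative:
  assumes V: "(V, \<phi>) \<in> \<A>" and I: "open I" "t \<in> I" "\<gamma> t \<in> V" "smooth_curve \<A> I \<gamma>"
  obtains c where "((\<phi> \<circ> \<gamma>) has_vector_derivative c) (at t)"
proof -
  have "smooth_on {t \<in> I. \<gamma> t \<in> V} (\<phi> \<circ> \<gamma>)"
    using V I(4) unfolding smooth_curve_def by blast
  then have "(\<phi> \<circ> \<gamma>) differentiable (at t)"
    using I(2,3) by (auto intro!: differentiableI smooth_on_has_derivative)
  then show ?thesis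
    unfolding vector_derivative_works by (rule that)
qed

text \<open>This is the chain rule. Only continuity and one derivative at 0 are required of
  \<gamma>, so that it applies directly to the orbit of p0 under the translations.\<close>

lemma velocity_eq:
  assumes V: "(V, \<phi>) \<in> \<A>" and I: "open I" "0 \<in> I" "continuous_on I \<gamma>" "\<gamma> 0 \<in> V"
    and c: "((\<phi> \<circ> \<gamma>) has_vector_derivative c) (at 0)"
  shows "velocity \<A> \<gamma> = coord_tangent \<A> V \<phi> (\<gamma> 0) c"
proof
  fix f
  show "velocity \<A> \<gamma> f = coord_tangent \<A> V \<phi> (\<gamma> 0) c f"
  proof (cases "smooth_near \<A> (\<gamma> 0) f")
    case True
    let ?f = "f \<circ> inv_into V \<phi>"
    \<comment> \<open>Inserting the chart and its inverse between \<open>f\<close> and \<gamma> is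
      legitimate only while \<gamma> stays in \<open>V\<close>, hence on this open set of
      times.\<close>
    have op: "open {t \<in> I. \<gamma> t \<in> V}"
      using continuous_open_preimage[OF I(3,1) chartD(1)[OF V]] by (simp add: vimage_def Int_def)
    have "(?f has_derivative frechet_derivative ?f (at (\<phi> (\<gamma> 0)))) (at ((\<phi> \<circ> \<gamma>) 0))"
      using smooth_near_has_derivative[OF True V I(4)] by simp
    from vector_derivative_diff_chain_within[OF c has_derivative_at_withinI[OF this]]
    have "((?f \<circ> (\<phi> \<circ> \<gamma>)) has_vector_derivative frechet_derivative ?f (at (\<phi> (\<gamma> 0))) c) (at 0)" .
    then have "((f \<circ> \<gamma>) has_vector_derivative frechet_derivative ?f (at (\<phi> (\<gamma> 0))) c) (at 0)"
      by (rule has_vector_derivative_transform_within_open[OF _ op])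
        (use I chart_inv[OF V] in auto)
    then show ?thesis
      using True by (simp add: velocity_def coord_tangent_def has_real_derivative_iff_has_vector_derivative[symmetric] DERIV_imp_deriv)
  qed (simp add: velocity_def coord_tangent_def)
qed

text \<open>Lines in a chart realise every component vector as a velocity. They yield all tangent
  vectors, the coordinate vectors, and the curve inside S that contradicts transversality.\<close>

lemma line_curve:
  assumes V: "(V, \<phi>) \<in> \<A>" and "p \<in> V"
  defines "\<gamma> \<equiv> \<lambda>c t. inv_into V \<phi> (\<phi> p + t *\<^sub>R c)"
  obtains e where "0 < e" "\<And>t. t \<in> {-e<..<e} \<Longrightarrow> \<phi> p + t *\<^sub>R c \<in> \<phi> ` V"
    "smooth_curve \<A> {-e<..<e} (\<gamma> c)" "velocity \<A> (\<gamma> c) = coord_tangent \<A> V \<phi> p c"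
proof -
  let ?l = "\<lambda>t::real. \<phi> p + t *\<^sub>R c"
  have cont: "continuous_on UNIV ?l"
    by (intro continuous_intros)
  \<comment> \<open>The line has to stay in the image of the chart, since \<open>inv_into\<close> is
    arbitrary outside it; this fixes \<open>e\<close>.\<close>
  have "open (?l -` (\<phi> ` V))" "0 \<in> ?l -` (\<phi> ` V)"
    using continuous_open_vimage[OF chartD(2)[OF V], of ?l] cont assms(2)
    by (auto simp: continuous_on_eq_continuous_at)
  then obtain e where e: "0 < e" "ball 0 e \<subseteq> ?l -` (\<phi> ` V)"
    by (rule openE)
  have in_img: "?l t \<in> \<phi> ` V" if "t \<in> {-e<..<e}" for t
    using that e(2) by (auto simp: subset_iff dist_real_def)
  have eq: "\<phi> (\<gamma> c t) = ?l t" if "t \<in> {-e<..<e}" for t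
    unfolding \<gamma>_def using in_img[OF that] by (simp add: f_inv_into_f)
  have inV: "\<gamma> c ` {-e<..<e} \<subseteq> V"
    unfolding \<gamma>_def using in_img inv_into_into[of _ \<phi> V] by blast
  have "smooth_on {-e<..<e} ?l"
    by (intro smooth_on_add smooth_on_scaleR smooth_on_const smooth_on_ident) auto
  then have "smooth_on {-e<..<e} (\<phi> \<circ> \<gamma> c)"
    by (rule smooth_on_cong[rotated]) (use eq in auto)
  with inV have sm: "smooth_curve \<A> {-e<..<e} (\<gamma> c)"
    by (intro smooth_curveI[OF V]) auto
  have g0: "\<gamma> c 0 = p"
    using chart_inv[OF V assms(2)] by (simp add: \<gamma>_def)
  have "(?l has_vector_derivative c) (at 0)"
    by (auto intro!: derivative_eq_intros)
  then have "((\<phi> \<circ> \<gamma> c) has_vector_derivative c) (at 0)"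
    by (rule has_vector_derivative_transform_within_open[of _ _ _ "{-e<..<e}"])
      (use e(1) eq in auto)
  with sm e(1) g0 assms(2) have "velocity \<A> (\<gamma> c) = coord_tangent \<A> V \<phi> p c"
    using velocity_eq[OF V, of "{-e<..<e}" "\<gamma> c" c] by (simp add: smooth_curve_def)
  with e(1) in_img sm show ?thesis
    by (rule that)
qed

lemma tangent_space_eq:
  assumes V: "(V, \<phi>) \<in> \<A>" and "p \<in> V"
  shows "tangent_space \<A> p = range (coord_tangent \<A> V \<phi> p)"
proof
  show "tangent_space \<A> p \<subseteq> range (coord_tangent \<A> V \<phi> p)"
  proof
    fix X assume "X \<in> tangent_space \<A> p"
    then obtain \<gamma> e where \<gamma>: "X = velocity \<A> \<gamma>" "\<gamma> 0 = p" "0 < e" "smooth_curve \<A> {-e<..<e} \<gamma>"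
      unfolding tangent_space_def by blast
    then have "open {-e<..<e}" "0 \<in> {-e<..<e}" "\<gamma> 0 \<in> V"
      using assms(2) by auto
    then obtain c where "((\<phi> \<circ> \<gamma>) has_vector_derivative c) (at 0)"
      using smooth_curve_has_derivative[OF V] \<gamma>(4) by blast
    then have "X = coord_tangent \<A> V \<phi> p c"
      using velocity_eq[OF V, of "{-e<..<e}" \<gamma> c] \<gamma> assms(2) by (simp add: smooth_curve_def)
    then show "X \<in> range (coord_tangent \<A> V \<phi> p)" by blast
  qed
  show "range (coord_tangent \<A> V \<phi> p) \<subseteq> tangent_space \<A> p"
  proof clarify
    fix c
    obtain e where "0 < e" "smooth_curve \<A> {-e<..<e} (\<lambda>t. inv_into V \<phi> (\<phi> p + t *\<^sub>R c))"
      "velocity \<A> (\<lambda>t. inv_into V \<phi> (\<phi> p + t *\<^sub>R c)) = coord_tangent \<A> V \<phi> p c"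
      using line_curve[OF assms, of c] by metis
    then show "coord_tangent \<A> V \<phi> p c \<in> tangent_space \<A> p"
      unfolding tangent_space_def using chart_inv[OF assms]
      by (auto intro!: exI[of _ "\<lambda>t. inv_into V \<phi> (\<phi> p + t *\<^sub>R c)"])
  qed
qed

lemma coordinate_vector_eq:
  assumes "(V, \<phi>) \<in> \<A>" "q \<in> V"
  shows "coordinate_vector \<A> V \<phi> i q = coord_tangent \<A> V \<phi> q (axis i 1)"
  unfolding coordinate_vector_def using line_curve[OF assms, of "axis i 1"] by metis

lemma coord_tangent_add:
  assumes "(V, \<phi>) \<in> \<A>" "p \<in> V"
  shows "coord_tangent \<A> V \<phi> p (c + d) = (\<lambda>f. coord_tangent \<A> V \<phi> p c f + coord_tangent \<A> V \<phi> p d f)"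
proof
  fix f
  show "coord_tangent \<A> V \<phi> p (c + d) f = coord_tangent \<A> V \<phi> p c f + coord_tangent \<A> V \<phi> p d f"
    using linear_add[OF has_derivative_linear[OF smooth_near_has_derivative[OF _ assms, of f]]]
    by (simp add: coord_tangent_def)
qed

lemma coord_tangent_scaleR:
  assumes "(V, \<phi>) \<in> \<A>" "p \<in> V"
  shows "coord_tangent \<A> V \<phi> p (r *\<^sub>R c) = (\<lambda>f. r * coord_tangent \<A> V \<phi> p c f)"
proof
  fix f
  show "coord_tangent \<A> V \<phi> p (r *\<^sub>R c) f = r * coord_tangent \<A> V \<phi> p c f"
    using linear_cmul[OF has_derivative_linear[OF smooth_near_has_derivative[OF _ assms, of f]]]
    by (simp add: coord_tangent_def)
qed

lemma differential_coord_tangent: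
  assumes V: "(V, \<phi>) \<in> \<A>" and "p \<in> V"
  shows "differential \<A> (\<lambda>x. \<phi> x $ i) p (coord_tangent \<A> V \<phi> p c) = c $ i"
proof -
  let ?f = "(\<lambda>x. \<phi> x $ i) \<circ> inv_into V \<phi>"
  have eq: "y $ i = ?f y" if "y \<in> \<phi> ` V" for y
    using that by (simp add: f_inv_into_f)
  \<comment> \<open>Smoothness of the coordinate function comes first, because tangent vectors send
    functions that are not smooth near \<open>p\<close> to 0.\<close>
  have "smooth_on (\<phi> ` V) ?f"
    by (rule smooth_on_cong[OF _ smooth_on_bounded_linear[OF bounded_linear_vec_nth] eq])
      (use chartD(2)[OF V] in auto)
  then have "smooth_near \<A> p (\<lambda>x. \<phi> x $ i)"
    by (intro smooth_nearI[OF V]) (use chartD(1)[OF V] assms(2) in auto)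
  moreover have "(?f has_derivative (\<lambda>y. y $ i)) (at (\<phi> p))"
    by (rule has_derivative_transform_within_open[OF
          bounded_linear.has_derivative[OF bounded_linear_vec_nth has_derivative_ident] chartD(2)[OF V] _ eq])
      (use assms(2) in auto)
  then have "frechet_derivative ?f (at (\<phi> p)) = (\<lambda>y. y $ i)"
    by (rule frechet_derivative_at[symmetric])
  ultimately show ?thesis
    using tangent_space_eq[OF assms] by (simp add: differential_def coord_tangent_def)
qed

text \<open>In terms of components, \<alpha> becomes an alternating function of the rows of a
  matrix, hence a multiple of the determinant; the factor is its value at the identity matrix, that
  is, on the coordinate vectors.\<close>

lemma alternating_form_eq_coordinate_form:
  assumes V: "(V, \<phi>) \<in> \<A>" and q: "q \<in> V" and \<alpha>: "alternating_form \<A> q \<alpha>"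
    and X: "X \<in> UNIV \<rightarrow> tangent_space \<A> q"
  shows "\<alpha> X = \<alpha> (\<lambda>i. coordinate_vector \<A> V \<phi> i q) * coordinate_form \<A> \<phi> q X"
proof -
  let ?T = "coord_tangent \<A> V \<phi> q"
  define D :: "real^'n^'n \<Rightarrow> real" where "D C = \<alpha> (\<lambda>i. ?T (C $ i))" for C
  have T: "?T c \<in> tangent_space \<A> q" for c
    using tangent_space_eq[OF V q] by blast
  have upd: "(\<lambda>j. ?T ((\<chi> k. if k = i then r else C $ k) $ j)) = (\<lambda>j. ?T (C $ j))(i := ?T r)"
    for C :: "real^'n^'n" and i r
    by auto
  note \<alpha>' = bspec[OF \<alpha>[unfolded alternating_form_def]]
  \<comment> \<open>The definition adds a vector to the one already in slot \<open>i\<close>.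
    Placing \<open>u\<close> there first makes both summands free, as
    \<open>alternating_eq_det\<close> wants them.\<close>
  have add: "\<alpha> (Y(i := (\<lambda>f. u f + v f))) = \<alpha> (Y(i := u)) + \<alpha> (Y(i := v))"
    if "Y \<in> UNIV \<rightarrow> tangent_space \<A> q" "u \<in> tangent_space \<A> q" "v \<in> tangent_space \<A> q" for Y i u v
  proof -
    have "Y(i := u) \<in> UNIV \<rightarrow> tangent_space \<A> q"
      using that by auto
    then have "\<alpha> ((Y(i := u))(i := (\<lambda>f. (Y(i := u)) i f + v f))) = \<alpha> (Y(i := u)) + \<alpha> ((Y(i := u))(i := v))"
      by (rule \<alpha>'[THEN conjunct1, rule_format, OF _ that(3)])
    then show ?thesis by simp
  qed
  have scale: "\<alpha> (Y(i := (\<lambda>f. r * u f))) = r * \<alpha> (Y(i := u))"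
    if "Y \<in> UNIV \<rightarrow> tangent_space \<A> q" "u \<in> tangent_space \<A> q" for Y i u r
  proof -
    have "Y(i := u) \<in> UNIV \<rightarrow> tangent_space \<A> q"
      using that by auto
    then have "\<alpha> ((Y(i := u))(i := (\<lambda>f. r * (Y(i := u)) i f))) = r * \<alpha> (Y(i := u))"
      by (rule \<alpha>'[THEN conjunct2, THEN conjunct1, rule_format])
    then show ?thesis by simp
  qed
  have D: "D C = det C * D (mat 1)" for C
  proof (rule alternating_eq_det)
    show "D (\<chi> k. if k = i then r + s else A $ k) =
        D (\<chi> k. if k = i then r else A $ k) + D (\<chi> k. if k = i then s else A $ k)" for A i r s
      unfolding D_def upd coord_tangent_add[OF V q] by (rule add) (use T in auto)
    show "D (\<chi> k. if k = i then c *\<^sub>R r else A $ k) = c * D (\<chi> k. if k = i then r else A $ k)"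
      for A i c r
      unfolding D_def upd coord_tangent_scaleR[OF V q] by (rule scale) (use T in auto)
    show "D A = 0" if "i \<noteq> j" "A $ i = A $ j" for A i j
    proof -
      have "(\<lambda>i. ?T (A $ i)) \<in> UNIV \<rightarrow> tangent_space \<A> q"
        using T by auto
      moreover have "(\<lambda>i. ?T (A $ i)) i = (\<lambda>i. ?T (A $ i)) j"
        using that by simp
      ultimately show ?thesis
        unfolding D_def using that(1) by (intro \<alpha>'[THEN conjunct2, THEN conjunct2, rule_format]) auto
    qed
  qed
  have "\<exists>c. X i = ?T c" for i
    using X tangent_space_eq[OF V q] by auto
  then obtain c where c: "X i = ?T (c i)" for i
    by metis
  \<comment> \<open>The components of the vectors are rows in \<open>D\<close> but columns in
    \<open>coordinate_form\<close>.\<close>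
  have "coordinate_form \<A> \<phi> q X = det (transpose (\<chi> i. c i))"
    unfolding coordinate_form_def c differential_coord_tangent[OF V q] transpose_def by simp
  moreover have "\<alpha> X = D (\<chi> i. c i)"
    by (simp add: D_def c[symmetric])
  moreover have "\<alpha> (\<lambda>i. coordinate_vector \<A> V \<phi> i q) = D (mat 1)"
  proof -
    have "(mat 1 :: real^'n^'n) $ i = axis i 1" for i
      by (simp add: vec_eq_iff mat_def axis_def)
    then show ?thesis
      by (simp add: D_def coordinate_vector_eq[OF V q])
  qed
  ultimately show ?thesis
    using D[of "\<chi> i. c i"] by (simp add: det_transpose)
qed

text \<open>The transition maps of the new chart are the old ones composed with \<open>g\<close> or
  with its inverse \<open>F\<close>, hence smooth; maximality of the atlas then admits the
  chart.\<close>

lemma chart_composeI: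
  assumes V: "(V, \<phi>) \<in> \<A>" and D: "open D" "D \<subseteq> \<phi> ` V"
    and g: "open (g ` D)" "smooth_on D g" and F: "smooth_on (g ` D) F" "\<And>z. z \<in> D \<Longrightarrow> F (g z) = z"
  shows "({q \<in> V. \<phi> q \<in> D}, \<lambda>q. g (\<phi> q)) \<in> \<A>"
proof -
  define V' where "V' = {q \<in> V. \<phi> q \<in> D}"
  define x where "x = (\<lambda>q. g (\<phi> q))"
  have opV': "open V'"
    unfolding V'_def by (rule chart_vimage_open[OF V D(1)])
  have imgV': "\<phi> ` V' = D"
    unfolding V'_def using D(2) by auto
  have xV': "x ` V' = g ` D"
    unfolding x_def imgV'[symmetric] by (simp add: image_image)
  have inj: "inj_on x V'"
    unfolding x_def V'_def by (rule inj_onI) (metis (mono_tags, lifting) F(2) V chart_inv mem_Collect_eq)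
  \<comment> \<open>The inverse of \<open>x\<close> is \<open>F\<close> followed by the inverse of
    \<phi>; writing points of the image as \<open>g z\<close> removes \<open>F\<close>.\<close>
  have inv: "inv_into V' x (g z) = inv_into V \<phi> z" if "z \<in> D" for z
  proof (rule inv_into_f_eq[OF inj])
    have "inv_into V \<phi> z \<in> V" "\<phi> (inv_into V \<phi> z) = z"
      using that D(2) by (auto simp: inv_into_into f_inv_into_f)
    then show "inv_into V \<phi> z \<in> V'" "x (inv_into V \<phi> z) = g z"
      using that by (auto simp: V'_def x_def)
  qed
  have gcont: "continuous_on D g" and Fcont: "continuous_on (g ` D) F"
    using smooth_on_imp_continuous_on g(2) F(1) by auto
  have FD: "F ` g ` D \<subseteq> D"
    using F(2) by auto
  have "continuous_on V' x"
    unfolding x_def using imgV'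
    by (intro continuous_on_compose2[OF gcont continuous_on_subset[OF chartD(5)[OF V]]])
      (auto simp: V'_def)
  moreover have "continuous_on (g ` D) (inv_into V' x)"
  proof (rule continuous_on_eq)
    show "continuous_on (g ` D) (\<lambda>y. inv_into V \<phi> (F y))"
      using FD D(2) by (intro continuous_on_compose2[OF chartD(6)[OF V] Fcont]) auto
  qed (auto simp: inv F(2))
  ultimately have chart: "is_chart V' x"
    unfolding is_chart_def homeomorphism_def
    using opV' g(1) inj inv_into_image_cancel[OF inj subset_refl]
    by (simp add: xV' inv_into_f_f f_inv_into_f)
  have "smoothly_compatible V' x W \<psi>" if W: "(W, \<psi>) \<in> \<A>" for W \<psi>
  proof -
    \<comment> \<open>Written as a preimage under the continuous \<open>F\<close>, this domain is
      seen to be open.\<close>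
    have "x ` (V' \<inter> W) = {y \<in> g ` D. F y \<in> \<phi> ` (V \<inter> W)}"
    proof (intro subset_antisym subsetI)
      fix y assume "y \<in> {y \<in> g ` D. F y \<in> \<phi> ` (V \<inter> W)}"
      then obtain z q where "z \<in> D" "y = g z" "q \<in> V" "q \<in> W" "z = \<phi> q"
        using F(2) by auto
      then show "y \<in> x ` (V' \<inter> W)"
        by (auto simp: x_def V'_def)
    qed (use F(2) in \<open>auto simp: x_def V'_def\<close>)
    moreover have "open (\<phi> ` (V \<inter> W))"
      by (intro chart_image_open[OF V] open_Int chartD(1)[OF V] chartD(1)[OF W]) auto
    ultimately have op: "open (x ` (V' \<inter> W))"
      using continuous_open_preimage[OF Fcont g(1), of "\<phi> ` (V \<inter> W)"]
      by (simp only: vimage_def Int_def mem_Collect_eq)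
    have sub: "x ` (V' \<inter> W) \<subseteq> g ` D"
      using xV' by blast
    have "smooth_on (x ` (V' \<inter> W)) (\<lambda>y. (\<psi> \<circ> inv_into V \<phi>) (F y))"
      by (rule smooth_on_compose[OF op transition_smooth[OF V W] smooth_on_subset[OF F(1) sub]])
        (auto simp: x_def V'_def F(2))
    then have 1: "smooth_on (x ` (V' \<inter> W)) (\<psi> \<circ> inv_into V' x)"
    proof (rule smooth_on_cong[OF op])
      fix y assume "y \<in> x ` (V' \<inter> W)"
      then obtain z where "z \<in> D" "y = g z"
        using imgV' by (auto simp: x_def)
      then show "(\<psi> \<circ> inv_into V \<phi>) (F y) = (\<psi> \<circ> inv_into V' x) y"
        by (simp add: F(2) inv)
    qed
    have op2: "open (\<psi> ` (V' \<inter> W))"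
      using chart_image_open[OF W, of "V' \<inter> W"] opV' chartD(1)[OF W] by auto
    have "smooth_on (\<psi> ` (V' \<inter> W)) (\<lambda>y. g ((\<phi> \<circ> inv_into W \<psi>) y))"
    proof (rule smooth_on_compose[OF op2 g(2)])
      show "smooth_on (\<psi> ` (V' \<inter> W)) (\<phi> \<circ> inv_into W \<psi>)"
        by (rule smooth_on_subset[OF transition_smooth[OF W V]]) (auto simp: V'_def)
    qed (auto simp: V'_def chart_inv[OF W])
    then have 2: "smooth_on (\<psi> ` (V' \<inter> W)) (x \<circ> inv_into W \<psi>)"
      by (simp add: x_def o_def)
    from 1 2 show ?thesis
      by (simp add: smoothly_compatible_def)
  qed
  then have "\<forall>(W, \<psi>)\<in>\<A>. smoothly_compatible V' x W \<psi>"
    by auto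
  moreover have "\<forall>V \<phi>. is_chart V \<phi> \<and> (\<forall>(W, \<psi>)\<in>\<A>. smoothly_compatible V \<phi> W \<psi>) \<longrightarrow> (V, \<phi>) \<in> \<A>"
    using smooth_structure by (simp add: smooth_structure_def)
  ultimately have "(V', x) \<in> \<A>"
    using chart by simp
  then show ?thesis
    by (simp add: V'_def x_def)
qed

text \<open>Makes the domain of the flow box map open. The set is the preimage, under the chart
  inverse in the second variable, of the open set of pairs sent into \<open>W\<close>.\<close>

lemma open_smooth_family_domain:
  assumes "smooth_family \<A> I U \<Psi>" "open I" "open U" and V: "(V, \<phi>) \<in> \<A>" and W: "(W, \<psi>) \<in> \<A>"
  shows "open {(a, \<phi> q) |a q. a \<in> I \<and> q \<in> V \<inter> U \<and> \<Psi> a q \<in> W}"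
proof -
  let ?K = "{p \<in> I \<times> U. (\<lambda>(a, q). \<Psi> a q) p \<in> W}"
  have "open ?K"
    using continuous_open_preimage[of "I \<times> U" "\<lambda>(a, q). \<Psi> a q" W] assms(1-3) chartD(1)[OF W]
    by (simp add: smooth_family_def open_Times vimage_def Int_def)
  moreover have "continuous_on (UNIV \<times> \<phi> ` V) (\<lambda>p. (fst p :: real, inv_into V \<phi> (snd p)))"
    by (intro continuous_intros continuous_on_compose2[OF chartD(6)[OF V]]) auto
  ultimately have "open {p \<in> UNIV \<times> \<phi> ` V. (fst p, inv_into V \<phi> (snd p)) \<in> ?K}"
    using continuous_open_preimage[of "UNIV \<times> \<phi> ` V" "\<lambda>p. (fst p, inv_into V \<phi> (snd p))" ?K]
      chartD(2)[OF V] by (simp add: open_Times vimage_def Int_def)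
  also have "{p \<in> UNIV \<times> \<phi> ` V. (fst p, inv_into V \<phi> (snd p)) \<in> ?K} =
      {(a, \<phi> q) |a q. a \<in> I \<and> q \<in> V \<inter> U \<and> \<Psi> a q \<in> W}"
    by (auto simp: chart_inv[OF V])
  finally show ?thesis .
qed

text \<open>In the chart, \<open>F\<close> is a translation by \<open>v\<close>, whose derivative is
  the identity, so components do not change.\<close>

lemma push_forward_coord_tangent:
  assumes V: "(V, \<phi>) \<in> \<A>" and N: "open N" "N \<subseteq> V" "q \<in> N"
    and F: "\<And>q'. q' \<in> N \<Longrightarrow> F q' \<in> V" "\<And>q'. q' \<in> N \<Longrightarrow> \<phi> (F q') = \<phi> q' + v"
  shows "push_forward \<A> F q (coord_tangent \<A> V \<phi> q c) = coord_tangent \<A> V \<phi> (F q) c"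
proof
  fix f
  show "push_forward \<A> F q (coord_tangent \<A> V \<phi> q c) f = coord_tangent \<A> V \<phi> (F q) c f"
  proof (cases "smooth_near \<A> (F q) f")
    case True
    let ?f = "f \<circ> inv_into V \<phi>" and ?g = "(f \<circ> F) \<circ> inv_into V \<phi>"
    obtain M where M: "open M" "M \<subseteq> V" "F q \<in> M" "smooth_on (\<phi> ` M) ?f"
      using smooth_nearE[OF True V F(1)[OF N(3)]] .
    \<comment> \<open>The points of \<open>N\<close> sent into \<open>M\<close>, where
      \<open>f\<close> is known to be smooth in the chart. The condition is put as a preimage under
      the translation, which makes it open.\<close>
    define N' where "N' = {q' \<in> V. \<phi> q' \<in> (\<lambda>y. y + v) -` \<phi> ` M} \<inter> N"
    have "open ((\<lambda>y. y + v) -` \<phi> ` M)"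
      by (intro open_vimage chart_image_open[OF V M(1,2)] continuous_intros)
    then have N': "open N'" "N' \<subseteq> V" "N' \<subseteq> N" "q \<in> N'"
    proof -
      show "open N'"
        unfolding N'_def by (intro open_Int chart_vimage_open[OF V] N(1)) fact
      show "q \<in> N'"
        unfolding N'_def using N(2,3) M(3) F(2)[OF N(3)] by (auto simp flip: F(2)[OF N(3)])
    qed (auto simp: N'_def)
    have op: "open (\<phi> ` N')"
      by (rule chart_image_open[OF V N'(1,2)])
    have eq: "?f (y + v) = ?g y" if y: "y \<in> \<phi> ` N'" for y
    proof -
      obtain q' where q': "q' \<in> N" "y = \<phi> q'"
        using y N'(3) by auto
      then have "?f (y + v) = f (inv_into V \<phi> (\<phi> (F q')))"
        by (simp add: F(2))
      also have "\<dots> = ?g y"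
        using q' N(2) chart_inv[OF V, of q'] chart_inv[OF V F(1)[OF q'(1)]] by auto
      finally show ?thesis .
    qed
    have "smooth_on (\<phi> ` N') (\<lambda>y. ?f (y + v))"
      by (intro smooth_on_compose[OF op M(4)] smooth_on_add smooth_on_ident smooth_on_const op)
        (auto simp: N'_def)
    then have "smooth_on (\<phi> ` N') ?g"
      by (rule smooth_on_cong[OF op _ eq])
    \<comment> \<open>Without this, the tangent vector at \<open>q\<close> would give
      \<open>f \<circ> F\<close> its default value 0.\<close>
    then have g: "smooth_near \<A> q (f \<circ> F)"
      by (rule smooth_nearI[OF V N'(1,2,4)])
    have "(?f has_derivative frechet_derivative ?f (at (\<phi> (F q)))) (at (\<phi> q + v))"
      using smooth_near_has_derivative[OF True V F(1)[OF N(3)]] by (simp add: F(2)[OF N(3)])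
    moreover have "((\<lambda>y. y + v) has_derivative (\<lambda>y. y)) (at (\<phi> q))"
      by (auto intro!: derivative_eq_intros)
    ultimately have "((\<lambda>y. ?f (y + v)) has_derivative frechet_derivative ?f (at (\<phi> (F q)))) (at (\<phi> q))"
      using diff_chain_at[of "\<lambda>y. y + v" "\<lambda>y. y" "\<phi> q" ?f] by (simp add: o_def)
    then have "(?g has_derivative frechet_derivative ?f (at (\<phi> (F q)))) (at (\<phi> q))"
      by (rule has_derivative_transform_within_open[OF _ op _ eq]) (use N' in auto)
    from frechet_derivative_at[OF this] show ?thesis
      using True g by (simp add: push_forward_def coord_tangent_def)
  qed (simp add: push_forward_def coord_tangent_def)
qed

end


section \<open>Flow boxes\<close>

lemma smooth_family_continuous_on:
  assumes "smooth_family \<A> I U \<Psi>" "a \<in> I"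
  shows "continuous_on U (\<Psi> a)"
proof -
  have "continuous_on (I \<times> U) (\<lambda>(a, q). \<Psi> a q)"
    using assms(1) by (simp add: smooth_family_def)
  then have "continuous_on U (\<lambda>q. (\<lambda>(a, q). \<Psi> a q) (a, q))"
    by (rule continuous_on_compose2) (use assms(2) in \<open>auto intro!: continuous_intros\<close>)
  then show ?thesis by simp
qed

lemma smooth_family_continuous_on_orbit:
  assumes "smooth_family \<A> I U \<Psi>" "q \<in> U"
  shows "continuous_on I (\<lambda>a. \<Psi> a q)"
proof -
  have "continuous_on (I \<times> U) (\<lambda>(a, q). \<Psi> a q)"
    using assms(1) by (simp add: smooth_family_def)
  then have "continuous_on I (\<lambda>a. (\<lambda>(a, q). \<Psi> a q) (a, q))"
    by (rule continuous_on_compose2) (use assms(2) in \<open>auto intro!: continuous_intros\<close>)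
  then show ?thesis by simp
qed

context smooth_manifold
begin

text \<open>\<open>l\<close> is the prescribed index of the coordinate along the orbits, whereas the
  chart adapted to \<open>S\<close> brings an index \<open>k\<close> of its own; exchanging
  \<open>k\<close> and \<open>l\<close> reconciles them.\<close>

lemma flow_box_chart:
  fixes l :: 'n
  assumes U: "open U" "p0 \<in> U" and "\<delta> > 0" and fam: "smooth_family \<A> {-\<delta><..<\<delta>} U \<Psi>"
    and \<Psi>0: "\<And>q. q \<in> U \<Longrightarrow> \<Psi> 0 q = q"
    and \<Psi>_add: "\<And>a b q. a \<in> {-\<delta><..<\<delta>} \<Longrightarrow> b \<in> {-\<delta><..<\<delta>} \<Longrightarrow> a + b \<in> {-\<delta><..<\<delta>} \<Longrightarrow>
      q \<in> U \<Longrightarrow> \<Psi> b q \<in> U \<Longrightarrow> \<Psi> (a + b) q = \<Psi> a (\<Psi> b q)"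
    and S: "hypersurface \<A> S" "p0 \<in> S"
    and transv: "velocity \<A> (\<lambda>a. \<Psi> a p0) \<notin> tangent_space_of \<A> S p0"
  obtains V x d where "(V, x) \<in> \<A>" "p0 \<in> V" "V \<subseteq> U" "0 < d" "d \<le> \<delta>"
    "S \<inter> V = {q \<in> V. x q $ l = 0}" "x p0 = 0"
    "\<forall>q\<in>V. \<forall>a\<in>{-d<..<d}. \<Psi> a q \<in> V \<longrightarrow> x (\<Psi> a q) = x q + a *\<^sub>R axis l 1"
proof -
  define I where "I = {-\<delta><..<\<delta>}"
  have I: "open I" "0 \<in> I"
    using \<open>\<delta> > 0\<close> by (auto simp: I_def)
  note fam = fam[folded I_def] and \<Psi>_add = \<Psi>_add[folded I_def]
  obtain W \<phi> k where W: "(W, \<phi>) \<in> \<A>" "p0 \<in> W" and SW: "S \<inter> W = {q \<in> W. \<phi> q $ k = 0}"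
    using S unfolding hypersurface_def by fast
  define c where "c = \<phi> p0"
  have ck: "c $ k = 0"
    using SW W S(2) by (auto simp: c_def)
  define iv where "iv = inv_into W \<phi>"
  have iv: "iv (\<phi> q) = q" if "q \<in> W" for q
    using chart_inv[OF W(1) that] by (simp add: iv_def)
  have iv': "iv y \<in> W" "\<phi> (iv y) = y" if "y \<in> \<phi> ` W" for y
    using that iv by auto
  define \<Phi> where "\<Phi> = (\<lambda>(a, y). \<phi> (\<Psi> a (iv y)))"
  define Dm where "Dm = {(a, \<phi> q) |a q. a \<in> I \<and> q \<in> W \<inter> U \<and> \<Psi> a q \<in> W}"
  have Dm: "(a, y) \<in> Dm \<longleftrightarrow> a \<in> I \<and> y \<in> \<phi> ` W \<and> iv y \<in> U \<and> \<Psi> a (iv y) \<in> W" for a y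
    unfolding Dm_def using iv by auto
  have \<Phi>: "smooth_on Dm \<Phi>"
    using fam W unfolding smooth_family_def Dm_def \<Phi>_def iv_def by fast
  have opDm: "open Dm"
    unfolding Dm_def by (rule open_smooth_family_domain[OF fam I(1) U(1) W(1) W(1)])
  have Dm0: "(0, c) \<in> Dm"
    using W U I by (auto simp: Dm c_def iv \<Psi>0)

  \<comment> \<open>\<open>P\<close> forgets \<open>y $ l\<close>, which will serve as time, and
    moves \<open>y $ k\<close> into slot \<open>l\<close>. As \<open>c $ k = 0\<close>, the points
    \<open>c + P y\<close> lie in the hyperplane of \<open>S\<close>.\<close>
  define \<sigma> where "\<sigma> y = (\<chi> i. y $ Transposition.transpose k l i)" for y :: "real^'n"
  define P where "P y = (\<chi> i. if i = k then 0 else y $ Transposition.transpose k l i)" for y :: "real^'n"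
  have "linear \<sigma>" "linear P"
    unfolding \<sigma>_def P_def by (intro linearI; simp add: vec_eq_iff)+
  then have bl: "bounded_linear \<sigma>" "bounded_linear P"
    by (auto simp: linear_conv_bounded_linear)
  define h where "h y = (y $ l, c + P y)" for y
  have h_sm: "smooth_on UNIV h"
    unfolding h_def
    by (intro smooth_on_Pair smooth_on_add smooth_on_const smooth_on_bounded_linear[OF bl(2)]
        smooth_on_bounded_linear[OF bounded_linear_vec_nth]) auto
  define F where "F y = \<Phi> (h y)" for y
  have F_eq: "F y = \<phi> (\<Psi> (y $ l) (iv (c + P y)))" for y
    by (simp add: F_def \<Phi>_def h_def)
  define B where "B = h -` Dm"
  have B: "y \<in> B \<longleftrightarrow> y $ l \<in> I \<and> c + P y \<in> \<phi> ` W \<and> iv (c + P y) \<in> U \<and> \<Psi> (y $ l) (iv (c + P y)) \<in> W" for y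
    by (simp add: B_def h_def Dm)
  have P0: "P 0 = 0"
    using \<open>linear P\<close> by (rule linear_0)
  have opB: "open B"
    unfolding B_def using opDm smooth_on_imp_continuous_on[OF h_sm]
    by (intro open_vimage) (auto simp: continuous_on_eq_continuous_at)
  have B0: "0 \<in> B"
    using Dm0 by (simp add: B_def h_def P0)
  have F_sm: "smooth_on B F"
    unfolding F_def by (rule smooth_on_compose[OF opB \<Phi> smooth_on_subset[OF h_sm]]) (auto simp: B_def)

  define \<Phi>' where "\<Phi>' = frechet_derivative \<Phi> (at (0, c))"
  have d\<Phi>: "(\<Phi> has_derivative \<Phi>') (at (0, c))"
    unfolding \<Phi>'_def by (rule smooth_on_has_derivative[OF \<Phi> Dm0])
  have lin\<Phi>: "linear \<Phi>'"
    using d\<Phi> by (rule has_derivative_linear)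
  \<comment> \<open>At time 0 the translation is the identity, at least where \<open>iv y\<close>
    lies in \<open>U\<close>; this is a neighbourhood of \<open>c\<close>, so the partial derivative
    in space is the identity too.\<close>
  have \<Phi>'_snd: "\<Phi>' (0, w) = w" for w
  proof -
    have "((\<lambda>y. (0::real, y)) has_derivative (\<lambda>w. (0, w))) (at c)"
      by (auto intro!: derivative_eq_intros)
    from diff_chain_at[OF this d\<Phi>]
    have 1: "((\<lambda>y. \<Phi> (0, y)) has_derivative (\<lambda>w. \<Phi>' (0, w))) (at c)"
      by (simp add: o_def)
    have "((\<lambda>y. \<Phi> (0, y)) has_derivative (\<lambda>w. w)) (at c)"
    proof (rule has_derivative_transform_within_open[OF has_derivative_ident
          chart_inv_vimage_open[OF W(1) U(1)]])
      show "c \<in> {y \<in> \<phi> ` W. inv_into W \<phi> y \<in> U}"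
        using W U iv unfolding c_def iv_def by auto
      show "y = \<Phi> (0, y)" if "y \<in> {y \<in> \<phi> ` W. inv_into W \<phi> y \<in> U}" for y
        using that iv'(2) by (simp add: \<Phi>_def \<Psi>0 iv_def)
    qed
    from has_derivative_unique[OF 1 this] show ?thesis
      by (rule fun_cong)
  qed
  define X where "X = \<Phi>' (1, 0)"
  have \<Phi>'_eq: "\<Phi>' (t, w) = t *\<^sub>R X + w" for t w
  proof -
    have "\<Phi>' (t, w) = \<Phi>' (t *\<^sub>R (1, 0) + (0, w))"
      by simp
    also have "\<dots> = t *\<^sub>R X + w"
      unfolding linear_add[OF lin\<Phi>] linear_cmul[OF lin\<Phi>] \<Phi>'_snd X_def ..
    finally show ?thesis .
  qed
  have Xk: "X $ k \<noteq> 0"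
  proof
    assume "X $ k = 0"
    have "((\<lambda>a::real. (a, c)) has_vector_derivative (1, 0)) (at 0)"
      by (auto intro!: derivative_eq_intros)
    from vector_derivative_diff_chain_within[OF this has_derivative_at_withinI[OF d\<Phi>]]
    have "((\<phi> \<circ> (\<lambda>a. \<Psi> a p0)) has_vector_derivative X) (at 0)"
      using iv[OF W(2)] by (simp add: o_def \<Phi>_def X_def c_def)
    then have v: "velocity \<A> (\<lambda>a. \<Psi> a p0) = coord_tangent \<A> W \<phi> p0 X"
      using velocity_eq[OF W(1) I smooth_family_continuous_on_orbit[OF fam U(2)], of X] W(2)
      by (simp add: \<Psi>0 U)
    \<comment> \<open>With \<open>X $ k = 0\<close> this line keeps its k-th coordinate zero, so it
      runs in \<open>S\<close> with the velocity of the orbit.\<close>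
    define \<gamma> where "\<gamma> = (\<lambda>t. iv (c + t *\<^sub>R X))"
    obtain \<epsilon> where \<epsilon>: "0 < \<epsilon>" "\<And>t. t \<in> {-\<epsilon><..<\<epsilon>} \<Longrightarrow> c + t *\<^sub>R X \<in> \<phi> ` W"
      "smooth_curve \<A> {-\<epsilon><..<\<epsilon>} \<gamma>" "velocity \<A> \<gamma> = coord_tangent \<A> W \<phi> p0 X"
      using line_curve[OF W, of X] unfolding \<gamma>_def c_def iv_def by blast
    have "\<gamma> t \<in> S" if "t \<in> {-\<epsilon><..<\<epsilon>}" for t
    proof -
      have "\<gamma> t \<in> {q \<in> W. \<phi> q $ k = 0}"
        using iv'[OF \<epsilon>(2)[OF that]] ck \<open>X $ k = 0\<close> by (simp add: \<gamma>_def)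
      then show ?thesis
        using SW by blast
    qed
    moreover have "\<gamma> 0 = p0"
      using iv W by (simp add: \<gamma>_def c_def)
    ultimately have "velocity \<A> \<gamma> \<in> tangent_space_of \<A> S p0"
      unfolding tangent_space_of_def using \<epsilon>(1,3) by blast
    with transv v \<epsilon>(4) show False by simp
  qed
  have dF: "frechet_derivative F (at 0) v = v $ l *\<^sub>R X + P v" for v
  proof -
    have "(h has_derivative (\<lambda>v. (v $ l, P v))) (at 0)"
      unfolding h_def
      by (intro has_derivative_Pair bounded_linear.has_derivative[OF bounded_linear_vec_nth] has_derivative_ident)
        (auto intro!: derivative_eq_intros bounded_linear.has_derivative[OF bl(2)] simp: bl)
    then have "(F has_derivative \<Phi>' \<circ> (\<lambda>v. (v $ l, P v))) (at 0)"
      using diff_chain_at[of h _ 0 \<Phi> \<Phi>'] d\<Phi> by (simp add: F_def[abs_def] h_def P0 o_def)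
    from frechet_derivative_at[OF this, symmetric] show ?thesis
      by (simp add: \<Phi>'_eq)
  qed
  have inj: "v = 0" if "frechet_derivative F (at 0) v = 0" for v
  proof -
    \<comment> \<open>The k-th component of \<open>P v\<close> is zero, so the k-th equation reads
      \<open>v $ l * X $ k = 0\<close>. Then \<open>P v = 0\<close>, and it contains every other
      component of \<open>v\<close>.\<close>
    have *: "v $ l * X $ k + P v $ k = 0" "\<And>i. v $ l * X $ i + P v $ i = 0"
      using that unfolding dF vec_eq_iff by auto
    then have vl: "v $ l = 0"
      using Xk by (simp add: P_def)
    then have Pv: "P v $ Transposition.transpose k l i = 0" for i
      using * by simp
    have "v $ i = 0" for i
      using Pv[of i] vl by (auto simp: P_def Transposition.transpose_def split: if_splits)
    then show ?thesis
      by (simp add: vec_eq_iff)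
  qed
  obtain N N' g where N: "open N" "0 \<in> N" "N \<subseteq> B" "open N'" and hom: "homeomorphism N N' F g"
    and g_sm: "smooth_on N' g"
    using smooth_inverse_function_theorem[OF opB F_sm B0 inj] by metis
  have gF: "g (F y) = y" "F y \<in> N'" if "y \<in> N" for y
    using hom that by (auto simp: homeomorphism_def)
  have Fg: "F (g z) = z" "g z \<in> N" if "z \<in> N'" for z
    using hom that by (auto simp: homeomorphism_def)

  obtain r where r: "0 < r" "ball 0 r \<subseteq> N"
    using N(1,2) by (auto elim: openE)
  \<comment> \<open>With \<open>x q\<close> and \<open>a\<close> both below \<open>d\<close>, the
    bound \<open>r / 2\<close> keeps the translated coordinates in \<open>N\<close>, and \<delta>/2
    keeps the sum of the two times in the range of the group law.\<close>
  define d where "d = min (r / 2) (\<delta> / 2)"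
  have d: "0 < d" "d \<le> \<delta> / 2" "d \<le> r / 2"
    using r \<open>\<delta> > 0\<close> by (auto simp: d_def)
  \<comment> \<open>\<open>G\<close> inverts \<open>F\<close> on the hyperplane of \<open>S\<close>; keeping \<open>G (\<phi> q)\<close> in the injectivity domain of \<open>F\<close>
    forces \<open>x q $ l = 0\<close> at all points of \<open>S\<close> in the new chart.\<close>
  define G where "G z = \<sigma> (z - c)" for z
  have G: "G z $ l = 0" "P (G z) = z - c" if "z $ k = 0" for z
    using that ck by (auto simp: G_def \<sigma>_def P_def vec_eq_iff)
  have FG: "F (G z) = z" if "z $ k = 0" "z \<in> \<phi> ` W" "iv z \<in> U" for z
    using that iv' by (simp add: F_eq G \<Psi>0)
  \<comment> \<open>The first set bounds \<open>x q\<close> by \<open>d\<close>; the second keeps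
    the new chart inside \<open>W\<close> and \<open>U\<close>.\<close>
  define D where "D = {z \<in> N'. g z \<in> ball 0 d} \<inter> {z \<in> \<phi> ` W. iv z \<in> U} \<inter> G -` ball 0 r"
  have D: "z \<in> N'" "g z \<in> ball 0 d" "z \<in> \<phi> ` W" "iv z \<in> U" "G z \<in> ball 0 r" if "z \<in> D" for z
    using that by (auto simp: D_def)
  have opD: "open D"
    unfolding D_def
  proof (intro open_Int)
    show "open {z \<in> N'. g z \<in> ball 0 d}"
      using continuous_open_preimage[OF smooth_on_imp_continuous_on[OF g_sm] N(4), of "ball 0 d"]
      by (simp add: vimage_def Int_def)
    show "open {z \<in> \<phi> ` W. iv z \<in> U}"
      unfolding iv_def by (rule chart_inv_vimage_open[OF W(1) U(1)])
    show "open (G -` ball 0 r)"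
      unfolding G_def
      by (intro open_vimage continuous_intros bounded_linear.continuous_on[OF bl(1)]) auto
  qed
  define V where "V = {q \<in> W. \<phi> q \<in> D}"
  define x where "x = (\<lambda>q. g (\<phi> q))"
  have Vx: "(V, x) \<in> \<A>"
    unfolding V_def x_def
  proof (rule chart_composeI[OF W(1) opD])
    have "homeomorphism N' N g F"
      using hom by (rule homeomorphism_symD)
    moreover have "openin (top_of_set N') D"
      using opD D(1) by (auto simp: openin_open_eq[OF N(4)])
    ultimately have "openin (top_of_set N) (g ` D)"
      by (rule homeomorphism_imp_open_map)
    then show "open (g ` D)"
      using N(1) openin_open_trans by blast
    show "smooth_on (g ` D) F"
      using D(1) Fg(2) N(3) by (intro smooth_on_subset[OF F_sm]) blast
  qed (use D(1,3) Fg g_sm in \<open>auto intro: smooth_on_subset\<close>)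
  have V: "q \<in> W" "q \<in> U" "\<phi> q \<in> N'" "x q \<in> ball 0 d" "G (\<phi> q) \<in> ball 0 r" if "q \<in> V" for q
    using that D[of "\<phi> q"] iv by (auto simp: V_def x_def)
  have F0: "F 0 = c"
    using iv W by (simp add: F_eq P0 \<Psi>0 U c_def)
  have x0: "x p0 = 0"
    using gF(1)[OF N(2)] F0 by (simp add: x_def c_def)
  have "G c = 0"
    using linear_0[OF \<open>linear \<sigma>\<close>] by (simp add: G_def)
  then have "c \<in> D"
    using gF[OF N(2)] F0 W U iv d(1) r(1) by (auto simp: D_def c_def)
  then have p0V: "p0 \<in> V"
    using W by (simp add: V_def c_def)
  have Fx: "F (x q) = \<phi> q" if "q \<in> V" for q
    using Fg V that by (simp add: x_def)
  have xB: "x q \<in> B" if "q \<in> V" for q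
    using Fg(2)[OF V(3)[OF that]] N(3) by (auto simp: x_def)
  have "S \<inter> V = {q \<in> V. x q $ l = 0}"
  proof (intro subset_antisym subsetI)
    fix q assume q: "q \<in> S \<inter> V"
    then have "q \<in> V" and k0: "\<phi> q $ k = 0"
      using SW V(1) by auto
    have "F (G (\<phi> q)) = \<phi> q"
      using FG[OF k0] V[OF \<open>q \<in> V\<close>] iv by auto
    moreover have "G (\<phi> q) \<in> N"
      using V(5)[OF \<open>q \<in> V\<close>] r(2) by blast
    ultimately have "x q = G (\<phi> q)"
      using gF(1) by (metis x_def)
    then show "q \<in> {q \<in> V. x q $ l = 0}"
      using \<open>q \<in> V\<close> G(1)[OF k0] by simp
  next
    fix q assume q: "q \<in> {q \<in> V. x q $ l = 0}"
    then have "q \<in> V" and l0: "x q $ l = 0" by auto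
    have "\<phi> q = \<phi> (\<Psi> 0 (iv (c + P (x q))))"
      using Fx[OF \<open>q \<in> V\<close>] by (simp add: F_eq l0)
    also have "\<dots> = c + P (x q)"
      using xB[OF \<open>q \<in> V\<close>] iv' by (simp add: B \<Psi>0)
    finally have "\<phi> q $ k = 0"
      using ck by (simp add: P_def)
    then show "q \<in> S \<inter> V"
      using \<open>q \<in> V\<close> V(1) SW by blast
  qed
  moreover have "x (\<Psi> a q) = x q + a *\<^sub>R axis l 1" if "q \<in> V" "a \<in> {-d<..<d}" "\<Psi> a q \<in> V" for q a
  proof -
    \<comment> \<open>\<open>?s\<close> is the point of \<open>S\<close> from which the translation
      by time \<open>?y $ l\<close> reaches \<open>q\<close>; by the group law, \<Psi>_a(q) is
      reached from it at time \<open>a + ?y $ l\<close>.\<close>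
    let ?y = "x q" and ?s = "iv (c + P (x q))"
    have yB: "?y $ l \<in> I" "?s \<in> U" "\<Psi> (?y $ l) ?s \<in> W"
      using xB[OF that(1)] by (auto simp: B)
    have "\<phi> (\<Psi> (?y $ l) ?s) = \<phi> q"
      using Fx[OF that(1)] by (simp add: F_eq)
    then have s: "\<Psi> (?y $ l) ?s = q"
      using iv[OF yB(3)] iv[OF V(1)[OF that(1)]] by metis
    have "\<bar>?y $ l\<bar> < d"
      using V(4)[OF that(1)] component_le_norm_cart[of ?y l] by simp
    then have "a \<in> I" "a + ?y $ l \<in> I"
      using that(2) d by (auto simp: I_def)
    then have "\<Psi> (a + ?y $ l) ?s = \<Psi> a q"
      using \<Psi>_add[OF \<open>a \<in> I\<close> yB(1) _ yB(2)] V(2)[OF that(1)] by (simp add: s)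
    \<comment> \<open>A change of time leaves the starting point in \<open>S\<close> alone.\<close>
    moreover have "P (?y + a *\<^sub>R axis l 1) = P ?y"
      by (auto simp: P_def vec_eq_iff axis_def transpose_eq_iff)
    ultimately have F: "F (?y + a *\<^sub>R axis l 1) = \<phi> (\<Psi> a q)"
      by (simp add: F_eq add.commute)
    \<comment> \<open>\<open>g\<close> undoes \<open>F\<close> only on \<open>N\<close>; outside,
      \<open>F\<close> might take the same value at a point other than the one \<open>g\<close>
      returns.\<close>
    have "norm (?y + a *\<^sub>R axis l 1) \<le> norm ?y + \<bar>a\<bar>"
      using norm_triangle_ineq[of ?y "a *\<^sub>R axis l 1"] by simp
    also have "\<dots> < r"
      using V(4)[OF that(1)] that(2) d(3) by auto
    finally have "?y + a *\<^sub>R axis l 1 \<in> N"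
      using r(2) by (auto simp: subset_iff)
    from gF(1)[OF this] show ?thesis
      unfolding F by (simp add: x_def)
  qed
  moreover have "V \<subseteq> U" "d \<le> \<delta>"
    using V(2) d \<open>\<delta> > 0\<close> by auto
  ultimately show ?thesis
    using that[of V x d] Vx p0V d(1) x0 by blast
qed

end

(* x^j is the component with index e j.  The translation parameter is restricted to a smaller
   interval {-d<..<d}: an orbit may return to every neighbourhood of p0 after a fixed time. *)

theorem mainTheorem6:
  fixes \<A> :: "('a::{t2_space,second_countable_topology}, 'n::finite) chart set"
    and g :: "'a \<Rightarrow> 'a cotangent \<Rightarrow> 'a cotangent \<Rightarrow> real"
    and dv :: "('a, 'n) top_form"
    and \<Psi> :: "real \<Rightarrow> 'a \<Rightarrow> 'a"
    and U S :: "'a set" and p0 :: 'a and \<delta> :: real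
    and m :: nat and e :: "nat \<Rightarrow> 'n"
  assumes "bij_betw e {1..m+1} UNIV"
    and "smooth_structure \<A>"
    and "subriemannian \<A> g"
    and "volume_form \<A> dv"
    and "isometric_translations \<A> g dv p0 U \<delta> \<Psi>"
    and "hypersurface \<A> S" and "p0 \<in> S"
    and "transversal \<A> U \<Psi> S"
  shows "\<exists>V x d. (V, x) \<in> \<A> \<and> p0 \<in> V \<and> V \<subseteq> U \<and> 0 < d \<and> d \<le> \<delta> \<and>
           S \<inter> V = {q\<in>V. x q $ e (m+1) = 0} \<and>
           x p0 = 0 \<and>
           (\<forall>q\<in>V. \<forall>a\<in>{-d<..<d}. \<Psi> a q \<in> V \<longrightarrow>
              (\<forall>j\<in>{1..m}. x (\<Psi> a q) $ e j = x q $ e j) \<and>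
              x (\<Psi> a q) $ e (m+1) = x q $ e (m+1) + a) \<and>
           (\<exists>A. (\<forall>q\<in>V. \<forall>X \<in> UNIV \<rightarrow> tangent_space \<A> q.
                   dv q X = A q * coordinate_form \<A> x q X) \<and>
                (\<forall>q\<in>V. \<forall>a\<in>{-d<..<d}. \<Psi> a q \<in> V \<longrightarrow> A (\<Psi> a q) = A q))"
proof -
  interpret smooth_manifold \<A>
    by unfold_locales fact
  note iso = assms(5)[unfolded isometric_translations_def]
  have U: "open U" "p0 \<in> U" and "\<delta> > 0" and fam: "smooth_family \<A> {-\<delta><..<\<delta>} U \<Psi>"
    using iso by simp_all
  have \<Psi>0: "\<Psi> 0 q = q" if "q \<in> U" for q
    using iso that by simp
  have \<Psi>_add: "\<Psi> (a + b) q = \<Psi> a (\<Psi> b q)"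
    if "a \<in> {-\<delta><..<\<delta>}" "b \<in> {-\<delta><..<\<delta>}" "a + b \<in> {-\<delta><..<\<delta>}" "q \<in> U" "\<Psi> b q \<in> U" for a b q
  proof -
    have "\<forall>a\<in>{-\<delta><..<\<delta>}. \<forall>b\<in>{-\<delta><..<\<delta>}. \<forall>q\<in>U.
        a + b \<in> {-\<delta><..<\<delta>} \<and> \<Psi> b q \<in> U \<longrightarrow> \<Psi> (a + b) q = \<Psi> a (\<Psi> b q)"
      using iso by (elim conjE)
    from this[rule_format, OF that(1,2,4) conjI[OF that(3,5)]] show ?thesis .
  qed
  have dv: "dv (\<Psi> a q) (\<lambda>i. push_forward \<A> (\<Psi> a) q (X i)) = dv q X"
    if "a \<in> {-\<delta><..<\<delta>}" "q \<in> U" "\<Psi> a q \<in> U" "X \<in> UNIV \<rightarrow> tangent_space \<A> q" for a q X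
  proof -
    have "\<forall>a\<in>{-\<delta><..<\<delta>}. \<forall>q\<in>U. \<Psi> a q \<in> U \<longrightarrow> (\<forall>X \<in> UNIV \<rightarrow> tangent_space \<A> q.
        dv (\<Psi> a q) (\<lambda>i. push_forward \<A> (\<Psi> a) q (X i)) = dv q X)"
      using iso by (elim conjE)
    from bspec[OF bspec[OF this that(1)] that(2), THEN mp, OF that(3), THEN bspec, OF that(4)]
    show ?thesis .
  qed
  have transv: "velocity \<A> (\<lambda>a. \<Psi> a p0) \<notin> tangent_space_of \<A> S p0"
    using assms(7,8) U(2) unfolding transversal_def by blast
  let ?l = "e (m + 1)"
  obtain V x d where V: "(V, x) \<in> \<A>" "p0 \<in> V" "V \<subseteq> U" "0 < d" "d \<le> \<delta>"
    "S \<inter> V = {q \<in> V. x q $ ?l = 0}" "x p0 = 0"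
    and tr: "\<forall>q\<in>V. \<forall>a\<in>{-d<..<d}. \<Psi> a q \<in> V \<longrightarrow> x (\<Psi> a q) = x q + a *\<^sub>R axis ?l 1"
    by (rule flow_box_chart[where l = ?l, OF U \<open>\<delta> > 0\<close> fam \<Psi>0 \<Psi>_add assms(6,7) transv])
  have ne: "e j \<noteq> ?l" if "j \<in> {1..m}" for j
    using bij_betw_imp_inj_on[OF assms(1)] that by (auto dest: inj_onD)
  \<comment> \<open>The only possible choice, since \<open>coordinate_form\<close> equals 1 on the
    coordinate vectors.\<close>
  define A where "A q = dv q (\<lambda>i. coordinate_vector \<A> V x i q)" for q
  have "dv q X = A q * coordinate_form \<A> x q X"
    if "q \<in> V" "X \<in> UNIV \<rightarrow> tangent_space \<A> q" for q X
    unfolding A_def using assms(4) that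
    by (intro alternating_form_eq_coordinate_form[OF V(1)]) (auto simp: volume_form_def)
  moreover have "A (\<Psi> a q) = A q" if q: "q \<in> V" "a \<in> {-d<..<d}" "\<Psi> a q \<in> V" for q a
  proof -
    have a: "a \<in> {-\<delta><..<\<delta>}"
      using q(2) V(5) by auto
    \<comment> \<open>Pushing vectors forward differentiates, so the translation formula has to hold
      on a whole neighbourhood of \<open>q\<close>; continuity of \<open>\<Psi> a\<close> makes this
      set open.\<close>
    let ?N = "{q' \<in> V. \<Psi> a q' \<in> V}"
    have "open ?N"
      using continuous_open_preimage[OF continuous_on_subset[OF smooth_family_continuous_on[OF fam a] V(3)]
          chartD(1,1)[OF V(1)]] by (simp add: vimage_def Int_def)
    then have "push_forward \<A> (\<Psi> a) q (coordinate_vector \<A> V x i q) = coordinate_vector \<A> V x i (\<Psi> a q)" for i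
      unfolding coordinate_vector_eq[OF V(1) q(1)] coordinate_vector_eq[OF V(1) q(3)]
      using q tr by (intro push_forward_coord_tangent[OF V(1), of ?N]) auto
    then have "A (\<Psi> a q) = dv (\<Psi> a q) (\<lambda>i. push_forward \<A> (\<Psi> a) q (coordinate_vector \<A> V x i q))"
      by (simp add: A_def)
    also have "\<dots> = A q"
      unfolding A_def using q V(3) a
      by (intro dv) (auto simp: coordinate_vector_eq[OF V(1) q(1)] tangent_space_eq[OF V(1) q(1)])
    finally show ?thesis .
  qed
  ultimately show ?thesis
    using V tr ne
    by (intro exI[of _ V] exI[of _ x] exI[of _ d] conjI exI[of _ A]) (auto simp: axis_def)
qed

end
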